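(* Let $m\ge 1$, $n>3$ be integers with $n>2m$ and let $\Lambda=(\boldsymbol\lambda_1,\dots,\boldsymbol\lambda_n)$ be an admissible configuration in $\mathbb{C}^m$. Then the $(2n-2m-1)$-dimensional moment-angle manifold $\mathcal{M}_1^{(\Lambda,m,n)}$ associated to $\Lambda$ has a regular Poisson structure whose associated symplectic foliation $\mathcal{F}=\mathcal{F}_{(\Lambda,m,n)}$ is of dimension $2m$.
   Context: An $n$-tuple $\Lambda=(\boldsymbol\lambda_1,\dots,\boldsymbol\lambda_n)$ of vectors $\boldsymbol\lambda_j=(\lambda_j^1,\dots,\lambda_j^m)\in\mathbb{C}^m$ is an admissible configuration if: (i) (Siegel condition) $0$ belongs to the convex hull of $\{\boldsymbol\lambda_1,\dots,\boldsymbol\lambda_n\}$ in $\mathbb{C}^m=\mathbb{R}^{2m}$; (ii) (weak hyperbolicity) for all $1\le j_1<\dots<j_{2m}\le n$, $0$ does not belong to the convex hull of $\{\boldsymbol\lambda_{j_1},\dots,\boldsymbol\lambda_{j_{2m}}\}$. The moment-angle manifold $\mathcal{M}_1^{(\Lambda,m,n)}$ is the set of $Z=(z_1,\dots,z_n)\in\mathbb{C}^n$ with $\sum_{j=1}^n\lambda_j^k|z_j|^2=0$ for $k=1,\dots,m$ and $\sum_{j=1}^n|z_j|^2=1$; it is a smooth manifold of real dimension $2n-2m-1$. *)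

theory Defs
  imports "HOL-Analysis.Analysis" "HOL-Library.Disjoint_Sets"
begin

section \<open>Smooth maps and embedded submanifolds of Euclidean spaces\<close>

text \<open>Iterated directional derivatives; intended for open \<open>S\<close>.\<close>

fun Ck_on :: "nat \<Rightarrow> 'a::real_normed_vector set \<Rightarrow> ('a \<Rightarrow> 'b::real_normed_vector) \<Rightarrow> bool" where
  "Ck_on 0 S f \<longleftrightarrow> continuous_on S f"
| "Ck_on (Suc k) S f \<longleftrightarrow>
     (\<forall>x\<in>S. f differentiable (at x)) \<and>
     (\<forall>v. Ck_on k S (\<lambda>x. frechet_derivative f (at x) v))"

definition smooth_on :: "'a::real_normed_vector set \<Rightarrow> ('a \<Rightarrow> 'b::real_normed_vector) \<Rightarrow> bool" where
  "smooth_on S f \<longleftrightarrow> (\<forall>k. Ck_on k S f)"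

text \<open>A slice chart is a diffeomorphism \<open>\<Phi>\<close> of the open set \<open>U\<close> onto an open set \<open>V\<close> of the
  ambient space that straightens \<open>M\<close>: it maps \<open>U \<inter> M\<close> onto \<open>V \<inter> T\<close>, where the linear subspace
  \<open>T\<close> plays the role of the coordinate space.\<close>

definition slice_chart ::
    "'a::euclidean_space set \<Rightarrow> 'a set \<Rightarrow> ('a \<Rightarrow> 'a) \<Rightarrow> 'a set \<Rightarrow> bool" where
  "slice_chart M U \<Phi> T \<longleftrightarrow>
     open U \<and> subspace T \<and>
     (\<exists>V \<Psi>. open V \<and> homeomorphism U V \<Phi> \<Psi> \<and> smooth_on U \<Phi> \<and> smooth_on V \<Psi> \<and>
            \<Phi> ` (U \<inter> M) = V \<inter> T)"

definition smooth_submanifold :: "nat \<Rightarrow> 'a::euclidean_space set \<Rightarrow> bool" where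
  "smooth_submanifold d M \<longleftrightarrow>
     (\<forall>p\<in>M. \<exists>U \<Phi> T. p \<in> U \<and> slice_chart M U \<Phi> T \<and> dim T = d)"

text \<open>Elements of \<open>C\<^sup>\<infinity>(M)\<close> are represented by their extension by zero outside \<open>M\<close>, so that equality
  of functions on \<open>M\<close> is equality in HOL and the pointwise operations stay inside the set.\<close>

definition smooth_functions :: "'a::euclidean_space set \<Rightarrow> ('a \<Rightarrow> real) set" where
  "smooth_functions M = {f. (\<forall>x. x \<notin> M \<longrightarrow> f x = 0) \<and>
     (\<forall>p\<in>M. \<exists>U F. open U \<and> p \<in> U \<and> smooth_on U F \<and> (\<forall>x \<in> U \<inter> M. F x = f x))}"

definition smooth_curve_with_velocity ::
    "'a::euclidean_space set \<Rightarrow> 'a \<Rightarrow> 'a \<Rightarrow> (real \<Rightarrow> 'a) \<Rightarrow> bool" where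
  "smooth_curve_with_velocity M p v \<gamma> \<longleftrightarrow>
     (\<exists>e>0. smooth_on {-e<..<e} \<gamma> \<and> \<gamma> ` {-e<..<e} \<subseteq> M) \<and>
     \<gamma> 0 = p \<and> (\<gamma> has_vector_derivative v) (at 0)"

definition tangent_space :: "'a::euclidean_space set \<Rightarrow> 'a \<Rightarrow> 'a set" where
  "tangent_space M p = {v. \<exists>\<gamma>. smooth_curve_with_velocity M p v \<gamma>}"


section \<open>Foliations\<close>

text \<open>A \<open>k\<close>-dimensional foliation of \<open>M\<close>: a partition into connected leaves such that around every
  point there are coordinates \<open>\<Phi>\<close> of \<open>M\<close> in which the connected components of the trace of each
  leaf are the slices parallel to a \<open>k\<close>-dimensional coordinate subspace \<open>S\<close>.\<close>

definition foliation :: "nat \<Rightarrow> 'a::euclidean_space set \<Rightarrow> 'a set set \<Rightarrow> bool" where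
  "foliation k M \<F> \<longleftrightarrow>
     partition_on M \<F> \<and> (\<forall>L\<in>\<F>. connected L) \<and>
     (\<forall>p\<in>M. \<exists>U \<Phi> T S. p \<in> U \<and> slice_chart M U \<Phi> T \<and>
        subspace S \<and> S \<subseteq> T \<and> dim S = k \<and>
        (\<forall>L\<in>\<F>. \<forall>C\<in>components (U \<inter> L). \<exists>c. C = {x \<in> U \<inter> M. \<Phi> x - c \<in> S}))"


section \<open>Poisson structures\<close>

text \<open>A Poisson structure is given by its bracket on \<open>C\<^sup>\<infinity>(M)\<close>; the values of \<open>B\<close> at other
  arguments are irrelevant.\<close>

definition poisson_structure ::
    "'a::euclidean_space set \<Rightarrow> (('a \<Rightarrow> real) \<Rightarrow> ('a \<Rightarrow> real) \<Rightarrow> ('a \<Rightarrow> real)) \<Rightarrow> bool" where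
  "poisson_structure M B \<longleftrightarrow>
     (\<forall>f\<in>smooth_functions M. \<forall>g\<in>smooth_functions M. B f g \<in> smooth_functions M) \<and>
     (\<forall>f\<in>smooth_functions M. \<forall>g\<in>smooth_functions M. \<forall>h\<in>smooth_functions M. \<forall>a b.
        B (\<lambda>x. a * f x + b * g x) h = (\<lambda>x. a * B f h x + b * B g h x)) \<and>
     (\<forall>f\<in>smooth_functions M. \<forall>g\<in>smooth_functions M. B f g = (\<lambda>x. - B g f x)) \<and>
     (\<forall>f\<in>smooth_functions M. \<forall>g\<in>smooth_functions M. \<forall>h\<in>smooth_functions M.
        B f (\<lambda>x. g x * h x) = (\<lambda>x. B f g x * h x + g x * B f h x)) \<and>
     (\<forall>f\<in>smooth_functions M. \<forall>g\<in>smooth_functions M. \<forall>h\<in>smooth_functions M.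
        (\<lambda>x. B f (B g h) x + B g (B h f) x + B h (B f g) x) = (\<lambda>x. 0))"

text \<open>\<open>v\<close> is the value at \<open>p\<close> of the Hamiltonian vector field \<open>X\<^sub>f = {f, \<cdot>}\<close>: the derivative of every
  \<open>g\<close> in direction \<open>v\<close> is \<open>{f, g}(p)\<close>.\<close>

definition is_hamiltonian_vector ::
    "'a::euclidean_space set \<Rightarrow> (('a \<Rightarrow> real) \<Rightarrow> ('a \<Rightarrow> real) \<Rightarrow> ('a \<Rightarrow> real)) \<Rightarrow>
     ('a \<Rightarrow> real) \<Rightarrow> 'a \<Rightarrow> 'a \<Rightarrow> bool" where
  "is_hamiltonian_vector M B f p v \<longleftrightarrow>
     v \<in> tangent_space M p \<and>
     (\<forall>g\<in>smooth_functions M. \<forall>\<gamma>. smooth_curve_with_velocity M p v \<gamma> \<longrightarrow>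
        ((\<lambda>t. g (\<gamma> t)) has_real_derivative B f g p) (at 0))"

definition characteristic_space ::
    "'a::euclidean_space set \<Rightarrow> (('a \<Rightarrow> real) \<Rightarrow> ('a \<Rightarrow> real) \<Rightarrow> ('a \<Rightarrow> real)) \<Rightarrow> 'a \<Rightarrow> 'a set" where
  "characteristic_space M B p = {v. \<exists>f\<in>smooth_functions M. is_hamiltonian_vector M B f p v}"

text \<open>The dimension of the characteristic space at \<open>p\<close> is the rank of the Poisson tensor there.\<close>

definition regular_poisson_structure ::
    "'a::euclidean_space set \<Rightarrow> (('a \<Rightarrow> real) \<Rightarrow> ('a \<Rightarrow> real) \<Rightarrow> ('a \<Rightarrow> real)) \<Rightarrow> bool" where
  "regular_poisson_structure M B \<longleftrightarrow>
     poisson_structure M B \<and> (\<exists>r. \<forall>p\<in>M. dim (characteristic_space M B p) = r)"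

text \<open>For a regular Poisson structure the symplectic foliation is the one that integrates the
  characteristic distribution: the leaf through \<open>p\<close> is the set of all points that can be joined
  to \<open>p\<close> by a piecewise \<open>C\<^sup>1\<close> curve in \<open>M\<close> tangent to this distribution.\<close>

definition characteristic_path ::
    "'a::euclidean_space set \<Rightarrow> (('a \<Rightarrow> real) \<Rightarrow> ('a \<Rightarrow> real) \<Rightarrow> ('a \<Rightarrow> real)) \<Rightarrow> (real \<Rightarrow> 'a) \<Rightarrow> bool" where
  "characteristic_path M B \<gamma> \<longleftrightarrow>
     path \<gamma> \<and> path_image \<gamma> \<subseteq> M \<and>
     (\<exists>N. finite N \<and> \<gamma> C1_differentiable_on ({0..1} - N) \<and>
        (\<forall>t\<in>{0..1} - N. vector_derivative \<gamma> (at t) \<in> characteristic_space M B (\<gamma> t)))"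

definition symplectic_leaf ::
    "'a::euclidean_space set \<Rightarrow> (('a \<Rightarrow> real) \<Rightarrow> ('a \<Rightarrow> real) \<Rightarrow> ('a \<Rightarrow> real)) \<Rightarrow> 'a \<Rightarrow> 'a set" where
  "symplectic_leaf M B p =
     {q. \<exists>\<gamma>. characteristic_path M B \<gamma> \<and> pathstart \<gamma> = p \<and> pathfinish \<gamma> = q}"

definition symplectic_foliation ::
    "'a::euclidean_space set \<Rightarrow> (('a \<Rightarrow> real) \<Rightarrow> ('a \<Rightarrow> real) \<Rightarrow> ('a \<Rightarrow> real)) \<Rightarrow> 'a set set" where
  "symplectic_foliation M B = symplectic_leaf M B ` M"


section \<open>Admissible configurations and moment-angle manifolds\<close>

text \<open>\<open>\<Lambda> $ j $ k\<close> is the \<open>k\<close>-th coordinate of the \<open>j\<close>-th vector. Convex hulls are those of the real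
  vector space underlying \<open>complex ^ 'm\<close>. Strictly increasing index tuples are represented by
  index sets \<open>J\<close> of the given size (not by sets of vectors, as vectors may repeat).\<close>

definition siegel_condition :: "complex ^ 'm ^ 'n \<Rightarrow> bool" where
  "siegel_condition \<Lambda> \<longleftrightarrow> 0 \<in> convex hull (range (\<lambda>j. \<Lambda> $ j))"

definition weakly_hyperbolic :: "complex ^ 'm ^ 'n \<Rightarrow> bool" where
  "weakly_hyperbolic \<Lambda> \<longleftrightarrow>
     (\<forall>J :: 'n set. card J = 2 * CARD('m) \<longrightarrow> 0 \<notin> convex hull ((\<lambda>j. \<Lambda> $ j) ` J))"

definition admissible_configuration :: "complex ^ 'm ^ 'n \<Rightarrow> bool" where
  "admissible_configuration \<Lambda> \<longleftrightarrow> siegel_condition \<Lambda> \<and> weakly_hyperbolic \<Lambda>"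

definition moment_angle_manifold :: "complex ^ 'm ^ 'n \<Rightarrow> (complex ^ 'n) set" where
  "moment_angle_manifold \<Lambda> =
     {Z. (\<forall>k. (\<Sum>j\<in>UNIV. \<Lambda> $ j $ k * complex_of_real ((cmod (Z $ j))\<^sup>2)) = 0) \<and>
         (\<Sum>j\<in>UNIV. (cmod (Z $ j))\<^sup>2) = 1}"

end

theory Submission
  imports Defs
begin

text \<open>
  Let \<open>u \<in> \<complex>\<^sup>m = \<real>\<^sup>2\<^sup>m\<close> act on \<open>\<complex>\<^sup>n\<close> by \<open>z\<^sub>j \<mapsto> exp (\<i> \<langle>\<lambda>\<^sub>j, u\<rangle>) z\<^sub>j\<close>. The action preserves all \<open>|z\<^sub>j|\<close>,
  hence the manifold, and its generators \<open>X\<^sub>k\<close>, \<open>Y\<^sub>k\<close>, belonging to the unit vectors \<open>e\<^sub>k\<close> and \<open>\<i> e\<^sub>k\<close>, commute.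
  So \<open>\<Sum>\<^sub>k X\<^sub>k \<and> Y\<^sub>k\<close> is a Poisson tensor. Weak hyperbolicity makes the action locally free on the manifold,
  so the rank is \<open>2m\<close> everywhere, and the leaves are the orbits. Near a point \<open>p\<close> one can choose \<open>2m + 1\<close>
  indices \<open>j\<close> with \<open>p\<^sub>j \<noteq> 0\<close> such that the vectors \<open>(\<lambda>\<^sub>j, 1)\<close> form a basis of \<open>\<real>\<^sup>2\<^sup>m\<^sup>+\<^sup>1\<close>. The arguments of these
  \<open>z\<^sub>j\<close>, the defining equations of the manifold in that basis, and the other \<open>z\<^sub>k\<close>, rotated so as to become invariant
  under the action, are coordinates in which the action is a translation.
\<close>

section \<open>Smooth maps\<close>

text \<open>Elements of \<open>smooth_functions\<close> have only local extensions. So the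
  derivative of f along a field is taken along the orbit curve, which stays in the manifold, and an
  extension enters only to compute it. Commutation of the fields then splits into the symmetry of
  second derivatives and the commutation of diagonal linear maps, and the Jacobi identity becomes a
  polynomial identity in first and second derivatives. Pairing \<open>axis k 1\<close> with
  \<open>axis k \<i>\<close> makes the contraction with the Poisson tensor a multiplication by \<i>
  on \<open>complex ^ 'm\<close>, hence invertible; so the rank is the dimension of the orbit. The
  obstacle for the foliation is that orbits need not be closed: a leaf can meet a chart in
  infinitely many slices. The charts therefore turn the action into translation along a fixed
  subspace \<open>range s\<close>, and paths and components are compared with slices through the
  scalar functions \<open>\<Phi> y \<bullet> z\<close> with z orthogonal to \<open>range s\<close>,
  which are locally constant along the action.\<close>

lemma Ck_on_SucD: "Ck_on (Suc k) S f \<Longrightarrow> Ck_on k S f"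
proof (induction k arbitrary: f)
  case 0
  then show ?case
    by (auto intro!: continuous_at_imp_continuous_on differentiable_imp_continuous_within)
next
  case (Suc k)
  have "Ck_on (Suc k) S (\<lambda>x. frechet_derivative f (at x) v)" for v
    using Suc.prems by (subst (asm) Ck_on.simps) blast
  then show ?case using Suc.IH Suc.prems by simp
qed

lemma Ck_on_has_derivative:
  "Ck_on (Suc k) S f \<Longrightarrow> x \<in> S \<Longrightarrow> (f has_derivative frechet_derivative f (at x)) (at x)"
  by (simp add: frechet_derivative_works)

lemma Ck_on_cong:
  assumes "open S" "\<And>x. x \<in> S \<Longrightarrow> f x = g x" "Ck_on k S f"
  shows "Ck_on k S g"
  using assms(2,3)
proof (induction k arbitrary: f g)
  case 0
  then show ?case by (simp cong: continuous_on_cong)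
next
  case (Suc k)
  have d: "(g has_derivative frechet_derivative f (at x)) (at x)" if "x \<in> S" for x
    using has_derivative_transform_within_open[OF Ck_on_has_derivative[OF Suc.prems(2) that]
        assms(1) that] Suc.prems(1) by blast
  then have "frechet_derivative f (at x) = frechet_derivative g (at x)" if "x \<in> S" for x
    using frechet_derivative_at that by blast
  then have "Ck_on k S (\<lambda>x. frechet_derivative g (at x) v)" for v
    using Suc.IH[of "\<lambda>x. frechet_derivative f (at x) v" "\<lambda>x. frechet_derivative g (at x) v"]
      Suc.prems by simp
  then show ?case using d by (auto simp: differentiable_def)
qed

lemma Ck_on_subset: "Ck_on k S f \<Longrightarrow> T \<subseteq> S \<Longrightarrow> Ck_on k T f"
  by (induction k arbitrary: f) (auto intro: continuous_on_subset)

text \<open>An explicit derivative agrees with \<open>frechet_derivative\<close> on the open set,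
  and \<open>Ck_on_cong\<close> transports the remaining orders.\<close>

lemma Ck_on_SucI:
  assumes "open S" "\<And>x. x \<in> S \<Longrightarrow> (f has_derivative f' x) (at x)"
    and "\<And>v. Ck_on k S (\<lambda>x. f' x v)"
  shows "Ck_on (Suc k) S f"
proof -
  have "f' x = frechet_derivative f (at x)" if "x \<in> S" for x
    using assms(2)[OF that] by (rule frechet_derivative_at)
  then have "Ck_on k S (\<lambda>x. frechet_derivative f (at x) v)" for v
    by (intro Ck_on_cong[OF assms(1) _ assms(3)[of v]]) simp
  then show ?thesis using assms(2) by (auto simp: differentiable_def)
qed

lemma Ck_on_const: "open S \<Longrightarrow> Ck_on k S (\<lambda>x. c)"
proof (induction k arbitrary: c)
  case (Suc k)
  then show ?case by (intro Ck_on_SucI[where f' = "\<lambda>_ _. 0"]) auto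
qed simp

lemma Ck_on_bounded_linear:
  assumes "open S" "bounded_linear L"
  shows "Ck_on k S L"
proof (cases k)
  case 0
  then show ?thesis using assms(2) by (simp add: linear_continuous_on)
next
  case (Suc l)
  show ?thesis unfolding Suc
    by (rule Ck_on_SucI[where f' = "\<lambda>_. L"])
      (use assms in \<open>auto intro: bounded_linear_imp_has_derivative Ck_on_const\<close>)
qed

lemma Ck_on_linear_compose:
  assumes "open S" "bounded_linear L" "Ck_on k S f"
  shows "Ck_on k S (\<lambda>x. L (f x))"
  using assms(3)
proof (induction k arbitrary: f)
  case 0
  then show ?case using bounded_linear.continuous_on[OF assms(2)] by simp
next
  case (Suc k)
  show ?case
    by (rule Ck_on_SucI[where f' = "\<lambda>x v. L (frechet_derivative f (at x) v)"])
      (use Suc assms Ck_on_has_derivative[OF Suc.prems] in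
        \<open>auto intro: bounded_linear.has_derivative[OF assms(2)]\<close>)
qed

lemma Ck_on_add:
  assumes "open S" "Ck_on k S f" "Ck_on k S g"
  shows "Ck_on k S (\<lambda>x. f x + g x)"
  using assms(2,3)
proof (induction k arbitrary: f g)
  case 0
  then show ?case by (simp add: continuous_on_add)
next
  case (Suc k)
  show ?case
    by (rule Ck_on_SucI[where f' = "\<lambda>x v. frechet_derivative f (at x) v + frechet_derivative g (at x) v"])
      (use Suc assms Ck_on_has_derivative[OF Suc.prems(1)] Ck_on_has_derivative[OF Suc.prems(2)] in
        \<open>auto intro: has_derivative_add\<close>)
qed

lemma Ck_on_sum:
  assumes "open S" "\<And>i. i \<in> I \<Longrightarrow> Ck_on k S (f i)"
  shows "Ck_on k S (\<lambda>x. \<Sum>i\<in>I. f i x)"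
  using assms(2)
  by (induction I rule: infinite_finite_induct) (auto intro: Ck_on_const Ck_on_add assms(1))

lemma Ck_on_bilinear:
  assumes "open S" "bounded_bilinear B" "Ck_on k S f" "Ck_on k S g"
  shows "Ck_on k S (\<lambda>x. B (f x) (g x))"
  using assms(3,4)
proof (induction k arbitrary: f g)
  case 0
  then show ?case using bounded_bilinear.continuous_on[OF assms(2)] by simp
next
  case (Suc k)
  show ?case
  proof (rule Ck_on_SucI[OF assms(1)])
    show "((\<lambda>x. B (f x) (g x)) has_derivative
        (\<lambda>v. B (f x) (frechet_derivative g (at x) v) + B (frechet_derivative f (at x) v) (g x))) (at x)"
      if "x \<in> S" for x
      by (rule bounded_bilinear.FDERIV[OF assms(2)]) (rule Ck_on_has_derivative[OF _ that] Suc.prems)+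
    show "Ck_on k S (\<lambda>x. B (f x) (frechet_derivative g (at x) v) + B (frechet_derivative f (at x) v) (g x))" for v
      using Suc.prems by (intro Ck_on_add[OF assms(1)] Suc.IH) (auto intro: Ck_on_SucD)
  qed
qed

text \<open>\<open>Ck_on\<close> only speaks of derivatives in a fixed direction. A varying
  direction \<open>h x\<close> is split along \<open>Basis\<close>, so that functions of class
  \<open>Ck_on k\<close> multiply derivatives in fixed directions.\<close>

lemma Ck_on_frechet_expand:
  fixes f :: "'a::euclidean_space \<Rightarrow> 'b::real_normed_vector"
  assumes "open S" "Ck_on (Suc k) U f" "Ck_on k S g" "Ck_on k S h" "g ` S \<subseteq> U"
    and "\<And>b. b \<in> Basis \<Longrightarrow> Ck_on k S (\<lambda>x. frechet_derivative f (at (g x)) b)"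
  shows "Ck_on k S (\<lambda>x. frechet_derivative f (at (g x)) (h x))"
proof (rule Ck_on_cong[OF assms(1)])
  show "Ck_on k S (\<lambda>x. \<Sum>b\<in>Basis. (h x \<bullet> b) *\<^sub>R frechet_derivative f (at (g x)) b)"
    using assms(4,6)
    by (intro Ck_on_sum Ck_on_bilinear[OF _ bounded_bilinear_scaleR]
        Ck_on_linear_compose[OF _ bounded_linear_inner_left] assms(1)) auto
  fix x assume "x \<in> S"
  then have "linear (frechet_derivative f (at (g x)))"
    using assms by (intro linear_frechet_derivative) auto
  then have "frechet_derivative f (at (g x)) (\<Sum>b\<in>Basis. (h x \<bullet> b) *\<^sub>R b)
      = (\<Sum>b\<in>Basis. (h x \<bullet> b) *\<^sub>R frechet_derivative f (at (g x)) b)"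
    by (simp add: linear_sum linear_scale)
  then show "(\<Sum>b\<in>Basis. (h x \<bullet> b) *\<^sub>R frechet_derivative f (at (g x)) b)
      = frechet_derivative f (at (g x)) (h x)"
    by (simp add: euclidean_representation)
qed

text \<open>The chain rule applies the derivative of f to a direction that depends on x; expansion
  along \<open>Basis\<close> leaves derivatives of f in fixed directions, composed with g. Hence the
  induction varies f and keeps g.\<close>

lemma Ck_on_compose:
  fixes f :: "'a::euclidean_space \<Rightarrow> 'b::real_normed_vector"
  assumes "open S" "Ck_on k S g" "Ck_on k U f" "g ` S \<subseteq> U"
  shows "Ck_on k S (\<lambda>x. f (g x))"
  using assms(2-)
proof (induction k arbitrary: f)
  case 0
  then show ?case using continuous_on_compose2 by auto
next
  case (Suc k)
  show ?case
  proof (rule Ck_on_SucI[OF assms(1)])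
    show "((\<lambda>x. f (g x)) has_derivative
        (\<lambda>v. frechet_derivative f (at (g x)) (frechet_derivative g (at x) v))) (at x)"
      if "x \<in> S" for x
      using has_derivative_compose[OF Ck_on_has_derivative[OF Suc.prems(1) that], of f]
        Ck_on_has_derivative[OF Suc.prems(2), of "g x"] Suc.prems(3) that by blast
    show "Ck_on k S (\<lambda>x. frechet_derivative f (at (g x)) (frechet_derivative g (at x) v))" for v
    proof (rule Ck_on_frechet_expand[OF assms(1) Suc.prems(2) Ck_on_SucD[OF Suc.prems(1)]])
      show "Ck_on k S (\<lambda>x. frechet_derivative g (at x) v)"
        using Suc.prems(1) by simp
      show "Ck_on k S (\<lambda>x. frechet_derivative f (at (g x)) b)" for b
        using Suc.IH[of "\<lambda>y. frechet_derivative f (at y) b"] Ck_on_SucD[OF Suc.prems(1)] Suc.prems(2,3)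
        by simp
    qed (fact Suc.prems(3))
  qed
qed

section \<open>Closure properties of smooth maps\<close>

lemma smooth_on_Ck: "smooth_on S f \<Longrightarrow> Ck_on k S f"
  by (simp add: smooth_on_def)

lemma smooth_on_subset: "smooth_on S f \<Longrightarrow> T \<subseteq> S \<Longrightarrow> smooth_on T f"
  unfolding smooth_on_def using Ck_on_subset by blast

lemma smooth_on_const: "open S \<Longrightarrow> smooth_on S (\<lambda>x. c)"
  by (simp add: smooth_on_def Ck_on_const)

lemma smooth_on_bounded_linear: "open S \<Longrightarrow> bounded_linear L \<Longrightarrow> smooth_on S L"
  by (simp add: smooth_on_def Ck_on_bounded_linear)

lemma smooth_on_linear_compose:
  "open S \<Longrightarrow> bounded_linear L \<Longrightarrow> smooth_on S f \<Longrightarrow> smooth_on S (\<lambda>x. L (f x))"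
  by (simp add: smooth_on_def Ck_on_linear_compose)

lemma smooth_on_add:
  "open S \<Longrightarrow> smooth_on S f \<Longrightarrow> smooth_on S g \<Longrightarrow> smooth_on S (\<lambda>x. f x + g x)"
  by (simp add: smooth_on_def Ck_on_add)

lemma smooth_on_sum:
  "open S \<Longrightarrow> (\<And>i. i \<in> I \<Longrightarrow> smooth_on S (f i)) \<Longrightarrow> smooth_on S (\<lambda>x. \<Sum>i\<in>I. f i x)"
  by (simp add: smooth_on_def Ck_on_sum)

lemma smooth_on_bilinear:
  "open S \<Longrightarrow> bounded_bilinear B \<Longrightarrow> smooth_on S f \<Longrightarrow> smooth_on S g
    \<Longrightarrow> smooth_on S (\<lambda>x. B (f x) (g x))"
  by (simp add: smooth_on_def Ck_on_bilinear)

lemma smooth_on_mult: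
  fixes f g :: "_ \<Rightarrow> 'b::real_normed_algebra"
  shows "open S \<Longrightarrow> smooth_on S f \<Longrightarrow> smooth_on S g \<Longrightarrow> smooth_on S (\<lambda>x. f x * g x)"
  by (rule smooth_on_bilinear[OF _ bounded_bilinear_mult])

lemma smooth_on_minus: "open S \<Longrightarrow> smooth_on S f \<Longrightarrow> smooth_on S (\<lambda>x. - f x)"
  by (rule smooth_on_linear_compose[OF _ bounded_linear_minus[OF bounded_linear_ident]])

lemma smooth_on_diff:
  "open S \<Longrightarrow> smooth_on S f \<Longrightarrow> smooth_on S g \<Longrightarrow> smooth_on S (\<lambda>x. f x - g x)"
  using smooth_on_add[of S f "\<lambda>x. - g x"] smooth_on_minus[of S g] by simp

lemma smooth_on_compose:
  fixes f :: "'a::euclidean_space \<Rightarrow> 'b::real_normed_vector"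
  shows "open S \<Longrightarrow> smooth_on S g \<Longrightarrow> smooth_on U f \<Longrightarrow> g ` S \<subseteq> U \<Longrightarrow> smooth_on S (\<lambda>x. f (g x))"
  unfolding smooth_on_def using Ck_on_compose by blast

text \<open>With h a vector field, this lets derivations be iterated on local extensions.\<close>

lemma smooth_on_frechet_derivative:
  fixes f :: "'a::euclidean_space \<Rightarrow> 'b::real_normed_vector"
  assumes "open S" "smooth_on S f" "smooth_on S h"
  shows "smooth_on S (\<lambda>x. frechet_derivative f (at x) (h x))"
proof -
  have "Ck_on k S (\<lambda>x. frechet_derivative f (at x) (h x))" for k
  proof (rule Ck_on_frechet_expand[OF assms(1) smooth_on_Ck[OF assms(2)]
        Ck_on_bounded_linear[OF assms(1) bounded_linear_ident] smooth_on_Ck[OF assms(3)]])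
    show "Ck_on k S (\<lambda>x. frechet_derivative f (at x) b)" for b
      using smooth_on_Ck[OF assms(2), of "Suc k"] by simp
  qed simp
  then show ?thesis by (simp add: smooth_on_def)
qed

lemma smooth_on_has_derivative:
  "smooth_on S f \<Longrightarrow> x \<in> S \<Longrightarrow> (f has_derivative frechet_derivative f (at x)) (at x)"
  using Ck_on_has_derivative smooth_on_Ck by blast

lemma smooth_on_vec_lambda:
  fixes f :: "'a::euclidean_space \<Rightarrow> 'b::real_normed_vector ^ 'n::finite"
  assumes "open S" "\<And>i. smooth_on S (\<lambda>x. f x $ i)"
  shows "smooth_on S f"
proof -
  have "f = (\<lambda>x. \<Sum>i\<in>UNIV. axis i (f x $ i))"
    by (auto simp: vec_eq_iff axis_def)
  moreover have "bounded_linear (axis i :: 'b \<Rightarrow> 'b ^ 'n)" for i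
    by (rule bounded_linear_intro[where K = 1])
      (auto simp: vec_eq_iff axis_def norm_vec_def L2_set_def if_distrib[of norm]
        if_distrib[of "\<lambda>x. x\<^sup>2"] cong: if_cong)
  ultimately show ?thesis
    using smooth_on_sum[OF assms(1), of UNIV "\<lambda>i x. axis i (f x $ i)"]
      smooth_on_linear_compose[OF assms(1)] assms(2) by metis
qed

section \<open>Smoothness of the complex exponential, inverse and logarithm\<close>

lemma smooth_on_exp: "smooth_on UNIV (exp :: complex \<Rightarrow> complex)"
proof -
  have "Ck_on k UNIV (exp :: complex \<Rightarrow> complex)" for k
  proof (induction k)
    case 0
    then show ?case by (simp add: continuous_on_exp)
  next
    case (Suc k)
    show ?case
      by (rule Ck_on_SucI[where f' = "\<lambda>x v. exp x * v"])
        (auto simp flip: has_field_derivative_def intro!: derivative_eq_intros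
          Ck_on_bilinear[OF _ bounded_bilinear_mult] Suc Ck_on_const)
  qed
  then show ?thesis by (simp add: smooth_on_def)
qed

lemma smooth_on_inverse: "smooth_on (- {0}) (inverse :: complex \<Rightarrow> complex)"
proof -
  have o: "open (- {0::complex})" by auto
  have "Ck_on k (- {0}) (inverse :: complex \<Rightarrow> complex)" for k
  proof (induction k)
    case 0
    then show ?case by (auto intro!: continuous_intros)
  next
    case (Suc k)
    show ?case
    proof (rule Ck_on_SucI[OF o])
      show "(inverse has_derivative (\<lambda>v. (inverse x * inverse x) * (- v))) (at x)"
        if "x \<in> - {0}" for x :: complex
        using that by (auto intro!: derivative_eq_intros)
      show "Ck_on k (- {0}) (\<lambda>x. (inverse x * inverse x) * (- v))" for v :: complex
        by (intro Ck_on_bilinear[OF _ bounded_bilinear_mult] Suc Ck_on_const o)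
    qed
  qed
  then show ?thesis by (simp add: smooth_on_def)
qed

lemma smooth_on_Ln: "smooth_on (- \<real>\<^sub>\<le>\<^sub>0) Ln"
proof -
  have o: "open (- (\<real>\<^sub>\<le>\<^sub>0 :: complex set))" by (simp add: open_Compl)
  have "Ck_on k (- \<real>\<^sub>\<le>\<^sub>0) Ln" for k
  proof (cases k)
    case 0
    then show ?thesis by (auto intro!: continuous_intros)
  next
    case (Suc l)
    have "Ck_on l (- \<real>\<^sub>\<le>\<^sub>0) (inverse :: complex \<Rightarrow> complex)"
      by (rule Ck_on_subset[OF smooth_on_Ck[OF smooth_on_inverse]]) auto
    show ?thesis unfolding Suc
    proof (rule Ck_on_SucI[OF o])
      show "(Ln has_derivative (\<lambda>v. inverse x * v)) (at x)" if "x \<in> - \<real>\<^sub>\<le>\<^sub>0" for x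
        using that has_field_derivative_Ln by (simp flip: has_field_derivative_def)
      show "Ck_on l (- \<real>\<^sub>\<le>\<^sub>0) (\<lambda>x. inverse x * v)" for v :: complex
        by (intro Ck_on_bilinear[OF _ bounded_bilinear_mult] Ck_on_const o) fact
    qed
  qed
  then show ?thesis by (simp add: smooth_on_def)
qed

text \<open>The second difference over a parallelogram is a first difference, in the direction v, of
  a difference of two translates of f. The mean value theorem along v, and then along w for the
  derivative in the direction v, yields q. The extra \<open>+ h\<close> keeps the distance bound
  strict even if v and w vanish.\<close>

lemma second_difference_mean_value:
  fixes f :: "'a::real_normed_vector \<Rightarrow> real"
  assumes f: "Ck_on (Suc (Suc 0)) (ball p e) f" and h: "0 < h" "h * (norm v + norm w) < e"
  shows "\<exists>q. dist p q < h * (norm v + norm w) + h \<and>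
    f (p + h *\<^sub>R v + h *\<^sub>R w) - f (p + h *\<^sub>R v) - f (p + h *\<^sub>R w) + f p =
      h\<^sup>2 * frechet_derivative (\<lambda>x. frechet_derivative f (at x) v) (at q) w"
proof -
  define g where "g = (\<lambda>x. frechet_derivative f (at x) v)"
  have bnd: "norm (s *\<^sub>R v + t *\<^sub>R w) \<le> h * (norm v + norm w)"
    if "0 \<le> s" "s \<le> h" "0 \<le> t" "t \<le> h" for s t
  proof -
    have "norm (s *\<^sub>R v + t *\<^sub>R w) \<le> s * norm v + t * norm w"
      using norm_triangle_ineq[of "s *\<^sub>R v" "t *\<^sub>R w"] that by simp
    also have "\<dots> \<le> h * norm v + h * norm w"
      using that by (intro add_mono mult_right_mono) auto
    finally show ?thesis by (simp add: distrib_left)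
  qed
  have inb: "p + s *\<^sub>R v + t *\<^sub>R w \<in> ball p e"
    if "0 \<le> s" "s \<le> h" "0 \<le> t" "t \<le> h" for s t
  proof -
    have "dist p (p + s *\<^sub>R v + t *\<^sub>R w) = norm (s *\<^sub>R v + t *\<^sub>R w)"
      by (metis add.assoc add_diff_cancel_left' dist_commute dist_norm)
    then show ?thesis using bnd[OF that] h(2) by simp
  qed
  have df: "(f has_derivative frechet_derivative f (at x)) (at x)" if "x \<in> ball p e" for x
    using Ck_on_has_derivative[OF f that] .
  have dg: "(g has_derivative frechet_derivative g (at x)) (at x)" if "x \<in> ball p e" for x
    unfolding g_def by (rule Ck_on_has_derivative[OF _ that, of 0]) (use f in simp)
  have line: "((\<lambda>s. F (a + s *\<^sub>R d)) has_real_derivative frechet_derivative F (at (a + s *\<^sub>R d)) d) (at s)"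
    if "(F has_derivative frechet_derivative F (at (a + s *\<^sub>R d))) (at (a + s *\<^sub>R d))"
    for F :: "'a \<Rightarrow> real" and a d s
  proof -
    have "((\<lambda>s. a + s *\<^sub>R d) has_derivative (\<lambda>r. r *\<^sub>R d)) (at s)"
      by (auto intro!: derivative_eq_intros)
    from has_derivative_compose[OF this that]
    have "((\<lambda>s. F (a + s *\<^sub>R d)) has_derivative
        (\<lambda>r. frechet_derivative F (at (a + s *\<^sub>R d)) (r *\<^sub>R d))) (at s)" .
    moreover have "linear (frechet_derivative F (at (a + s *\<^sub>R d)))"
      using that by (rule has_derivative_linear)
    ultimately show ?thesis
      by (simp add: has_field_derivative_def linear_scale mult.commute[of _ "frechet_derivative _ _ _"]
          mult_commute_abs)
  qed
  have "\<exists>z>0. z < h \<and> (f (p + h *\<^sub>R w + h *\<^sub>R v) - f (p + h *\<^sub>R v)) - (f (p + h *\<^sub>R w + 0 *\<^sub>R v) - f (p + 0 *\<^sub>R v))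
      = (h - 0) * (g (p + h *\<^sub>R w + z *\<^sub>R v) - g (p + z *\<^sub>R v))"
  proof (rule MVT2)
    fix s assume s: "0 \<le> s" "s \<le> h"
    have "p + h *\<^sub>R w + s *\<^sub>R v \<in> ball p e" "p + s *\<^sub>R v \<in> ball p e"
      using inb[of s h] inb[of s 0] s h by (simp_all add: algebra_simps)
    then show "((\<lambda>s. f (p + h *\<^sub>R w + s *\<^sub>R v) - f (p + s *\<^sub>R v)) has_real_derivative
        g (p + h *\<^sub>R w + s *\<^sub>R v) - g (p + s *\<^sub>R v)) (at s)"
      unfolding g_def by (intro DERIV_diff line df)
  qed (use h in simp)
  then obtain z where z: "0 < z" "z < h"
    "f (p + h *\<^sub>R w + h *\<^sub>R v) - f (p + h *\<^sub>R v) - f (p + h *\<^sub>R w) + f p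
      = h * (g (p + h *\<^sub>R w + z *\<^sub>R v) - g (p + z *\<^sub>R v))"
    by auto
  have "\<exists>y>0. y < h \<and> g (p + z *\<^sub>R v + h *\<^sub>R w) - g (p + z *\<^sub>R v + 0 *\<^sub>R w)
      = (h - 0) * frechet_derivative g (at (p + z *\<^sub>R v + y *\<^sub>R w)) w"
    using inb[of z] z h by (intro MVT2 line dg) auto
  then obtain y where y: "0 < y" "y < h"
    "g (p + z *\<^sub>R v + h *\<^sub>R w) - g (p + z *\<^sub>R v)
      = h * frechet_derivative g (at (p + z *\<^sub>R v + y *\<^sub>R w)) w"
    by auto
  have "dist p (p + z *\<^sub>R v + y *\<^sub>R w) = norm (z *\<^sub>R v + y *\<^sub>R w)"
    by (metis add.assoc add_diff_cancel_left' dist_commute dist_norm)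
  then have "dist p (p + z *\<^sub>R v + y *\<^sub>R w) < h * (norm v + norm w) + h"
    using bnd[of z y] y z h by simp
  moreover have "f (p + h *\<^sub>R v + h *\<^sub>R w) - f (p + h *\<^sub>R v) - f (p + h *\<^sub>R w) + f p =
      h\<^sup>2 * frechet_derivative g (at (p + z *\<^sub>R v + y *\<^sub>R w)) w"
    using z(3) y(3) by (simp add: algebra_simps power2_eq_square)
  ultimately show ?thesis unfolding g_def by blast
qed

text \<open>Schwarz's theorem: the second difference does not change when v and w are exchanged, so
  the two mixed derivatives agree at some points q1 and q2 arbitrarily close to p, and continuity
  carries this to p.\<close>

lemma frechet_derivative_symmetric:
  fixes f :: "'a::real_normed_vector \<Rightarrow> real"
  assumes S: "open S" "p \<in> S" and f: "Ck_on (Suc (Suc 0)) S f"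
  shows "frechet_derivative (\<lambda>x. frechet_derivative f (at x) v) (at p) w =
    frechet_derivative (\<lambda>x. frechet_derivative f (at x) w) (at p) v"
proof -
  define D where "D v w x = frechet_derivative (\<lambda>x. frechet_derivative f (at x) v) (at x) w" for v w x
  have cont: "continuous (at p) (D v w)" for v w
    using f S by (simp add: D_def[abs_def] continuous_on_eq_continuous_at)
  obtain e where e: "e > 0" "ball p e \<subseteq> S"
    using S openE by blast
  have fb: "Ck_on (Suc (Suc 0)) (ball p e) f"
    using f e(2) by (rule Ck_on_subset)
  have "dist (D v w p) (D w v p) < 2 * r" if "r > 0" for r
  proof -
    have "\<exists>d>0. \<forall>q. dist q p < d \<longrightarrow> dist (D v w q) (D v w p) < r"
      using cont[of v w] that by (simp add: continuous_at_eps_delta)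
    then obtain d1 where d1: "d1 > 0" "\<And>q. dist p q < d1 \<Longrightarrow> dist (D v w q) (D v w p) < r"
      by (auto simp: dist_commute)
    have "\<exists>d>0. \<forall>q. dist q p < d \<longrightarrow> dist (D w v q) (D w v p) < r"
      using cont[of w v] that by (simp add: continuous_at_eps_delta)
    then obtain d2 where d2: "d2 > 0" "\<And>q. dist p q < d2 \<Longrightarrow> dist (D w v q) (D w v p) < r"
      by (auto simp: dist_commute)
    define m where "m = min e (min d1 d2)"
    define c where "c = norm v + norm w"
    \<comment> \<open>Because of the 2 in the denominator, \<open>h * c + h\<close> equals
      \<open>m - h\<close>, which is strictly below m.\<close>
    define h where "h = m / (c + 2)"
    have m: "m > 0" "m \<le> e" "m \<le> d1" "m \<le> d2" and c: "c \<ge> 0"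
      using e d1 d2 by (auto simp: m_def c_def)
    have h0: "h > 0" using m c by (simp add: h_def)
    have "h * (c + 2) = m" using c by (simp add: h_def)
    then have h: "h > 0" "h * c + h < m" using h0 by (simp_all add: algebra_simps)
    then have hc: "h * c < e" using m by linarith
    obtain q1 where q1: "dist p q1 < h * c + h"
      "f (p + h *\<^sub>R v + h *\<^sub>R w) - f (p + h *\<^sub>R v) - f (p + h *\<^sub>R w) + f p = h\<^sup>2 * D v w q1"
      using second_difference_mean_value[OF fb h(1), of v w] hc by (auto simp: D_def c_def)
    obtain q2 where q2: "dist p q2 < h * c + h"
      "f (p + h *\<^sub>R w + h *\<^sub>R v) - f (p + h *\<^sub>R w) - f (p + h *\<^sub>R v) + f p = h\<^sup>2 * D w v q2"
      using second_difference_mean_value[OF fb h(1), of w v] hc by (auto simp: D_def c_def add.commute)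
    have "h\<^sup>2 * D v w q1 = h\<^sup>2 * D w v q2"
      using q1(2) q2(2) by (simp add: algebra_simps)
    then have "D v w q1 = D w v q2" using h(1) by simp
    moreover have "dist (D v w q1) (D v w p) < r" "dist (D w v q2) (D w v p) < r"
      using d1(2)[of q1] d2(2)[of q2] q1(1) q2(1) h(2) m by linarith+
    ultimately show ?thesis
      using dist_triangle[of "D v w p" "D w v p" "D v w q1"] by (simp add: dist_commute)
  qed
  \<comment> \<open>For r half the distance, a positive distance would be less than itself.\<close>
  from this[of "dist (D v w p) (D w v p) / 2"] have "D v w p = D w v p"
    by fastforce
  then show ?thesis by (simp add: D_def)
qed

section \<open>The action of the vector group on the moment-angle manifold\<close>

text \<open>The inner product is the real one, so u ranges over a real vector group of dimension 2m,
  mapped into the torus of coordinate rotations. Its image there need not be closed.\<close>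

definition torus_act :: "complex ^ 'm ^ 'n \<Rightarrow> complex ^ 'm \<Rightarrow> complex ^ 'n \<Rightarrow> complex ^ 'n" where
  "torus_act \<Lambda> u Z = (\<chi> j. exp (\<i> * of_real (\<Lambda> $ j \<bullet> u)) * Z $ j)"

definition torus_field :: "complex ^ 'm ^ 'n \<Rightarrow> complex ^ 'm \<Rightarrow> complex ^ 'n \<Rightarrow> complex ^ 'n" where
  "torus_field \<Lambda> u Z = (\<chi> j. \<i> * of_real (\<Lambda> $ j \<bullet> u) * Z $ j)"

lemma torus_act_0 [simp]: "torus_act \<Lambda> 0 Z = Z"
  by (simp add: torus_act_def vec_eq_iff)

lemma torus_act_torus_act [simp]: "torus_act \<Lambda> u (torus_act \<Lambda> v Z) = torus_act \<Lambda> (u + v) Z"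
  by (simp add: torus_act_def vec_eq_iff inner_add_right distrib_left exp_add)

lemma norm_torus_act_nth [simp]: "cmod (torus_act \<Lambda> u Z $ j) = cmod (Z $ j)"
  by (simp add: torus_act_def norm_mult)

lemma torus_act_in_moment_angle_manifold [simp]:
  "torus_act \<Lambda> u Z \<in> moment_angle_manifold \<Lambda>' \<longleftrightarrow> Z \<in> moment_angle_manifold \<Lambda>'"
  by (simp add: moment_angle_manifold_def)

lemma bounded_linear_torus_field: "bounded_linear (torus_field \<Lambda> u)"
  by (intro linear_conv_bounded_linear[THEN iffD1] linearI)
    (simp_all add: torus_field_def vec_eq_iff algebra_simps scaleR_conv_of_real[where 'a = complex])

lemma linear_torus_field: "linear (\<lambda>u. torus_field \<Lambda> u Z)"
  by (intro linearI) (simp_all add: torus_field_def vec_eq_iff inner_add_right algebra_simps scaleR_conv_of_real[where 'a = complex])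

lemma torus_field_commute: "torus_field \<Lambda> u (torus_field \<Lambda> v Z) = torus_field \<Lambda> v (torus_field \<Lambda> u Z)"
  by (simp add: torus_field_def vec_eq_iff)

lemma smooth_on_torus_act: "smooth_on UNIV (\<lambda>u. torus_act \<Lambda> u Z)"
proof (rule smooth_on_vec_lambda[OF open_UNIV])
  fix j
  have "bounded_linear (\<lambda>u. \<i> * of_real (\<Lambda> $ j \<bullet> u))"
    by (intro bounded_linear_const_mult bounded_linear_compose[OF bounded_linear_of_real]
        bounded_linear_inner_right)
  then have "smooth_on UNIV (\<lambda>u. exp (\<i> * of_real (\<Lambda> $ j \<bullet> u)))"
    by (intro smooth_on_compose[OF open_UNIV _ smooth_on_exp] smooth_on_bounded_linear) auto
  then show "smooth_on UNIV (\<lambda>u. torus_act \<Lambda> u Z $ j)"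
    unfolding torus_act_def by (simp add: smooth_on_mult smooth_on_const)
qed

lemma smooth_on_torus_act_line: "smooth_on UNIV (\<lambda>t. torus_act \<Lambda> (t *\<^sub>R u) Z)"
  by (rule smooth_on_compose[OF open_UNIV _ smooth_on_torus_act])
    (auto intro: smooth_on_bounded_linear bounded_linear_scaleR_left)

text \<open>Smoothness supplies some derivative; its coordinates are then identified by restricting
  an entire function of the time parameter to the real line.\<close>

lemma torus_act_has_vector_derivative:
  "((\<lambda>t. torus_act \<Lambda> (t *\<^sub>R u) Z) has_vector_derivative torus_field \<Lambda> u (torus_act \<Lambda> (t *\<^sub>R u) Z)) (at t)"
proof -
  obtain D where D: "((\<lambda>t. torus_act \<Lambda> (t *\<^sub>R u) Z) has_vector_derivative D) (at t)"
    using smooth_on_has_derivative[OF smooth_on_torus_act_line UNIV_I] differentiableI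
      vector_derivative_works by blast
  have "D $ j = torus_field \<Lambda> u (torus_act \<Lambda> (t *\<^sub>R u) Z) $ j" for j
  proof -
    have "((\<lambda>t. torus_act \<Lambda> (t *\<^sub>R u) Z $ j) has_vector_derivative D $ j) (at t)"
      by (rule bounded_linear.has_vector_derivative[OF bounded_linear_vec_nth D])
    moreover have "((\<lambda>t. torus_act \<Lambda> (t *\<^sub>R u) Z $ j) has_vector_derivative
        torus_field \<Lambda> u (torus_act \<Lambda> (t *\<^sub>R u) Z) $ j) (at t)"
    proof -
      have "((\<lambda>z. exp (\<i> * of_real (\<Lambda> $ j \<bullet> u) * z) * Z $ j) has_field_derivative
          \<i> * of_real (\<Lambda> $ j \<bullet> u) * (exp (\<i> * of_real (\<Lambda> $ j \<bullet> u) * of_real t) * Z $ j)) (at (of_real t))"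
        by (auto intro!: derivative_eq_intros)
      from has_vector_derivative_real_field[OF this] show ?thesis
        by (simp add: torus_act_def torus_field_def mult_ac)
    qed
    ultimately show ?thesis by (rule vector_derivative_unique_at)
  qed
  then have "D = torus_field \<Lambda> u (torus_act \<Lambda> (t *\<^sub>R u) Z)"
    by (simp add: vec_eq_iff)
  then show ?thesis using D by simp
qed

lemma torus_act_smooth_curve:
  assumes "p \<in> moment_angle_manifold \<Lambda>'"
  shows "smooth_curve_with_velocity (moment_angle_manifold \<Lambda>') p (torus_field \<Lambda> u p)
    (\<lambda>t. torus_act \<Lambda> (t *\<^sub>R u) p)"
  unfolding smooth_curve_with_velocity_def
  using torus_act_has_vector_derivative[of \<Lambda> u p 0] assms
  by (auto intro!: exI[of _ 1] smooth_on_subset[OF smooth_on_torus_act_line])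

section \<open>Derivatives of smooth functions along the action\<close>

lemma smooth_functionsE:
  assumes "f \<in> smooth_functions M" "p \<in> M"
  obtains U F where "open U" "p \<in> U" "smooth_on U F" "\<And>x. x \<in> U \<Longrightarrow> x \<in> M \<Longrightarrow> F x = f x"
proof -
  from assms have "\<exists>U F. open U \<and> p \<in> U \<and> smooth_on U F \<and> (\<forall>x \<in> U \<inter> M. F x = f x)"
    unfolding smooth_functions_def by blast
  then show ?thesis using that by blast
qed

lemma smooth_functionsI:
  assumes "\<And>x. x \<notin> M \<Longrightarrow> f x = 0"
    and "\<And>p. p \<in> M \<Longrightarrow> \<exists>U F. open U \<and> p \<in> U \<and> smooth_on U F \<and> (\<forall>x \<in> U \<inter> M. F x = f x)"
  shows "f \<in> smooth_functions M"
  using assms by (simp add: smooth_functions_def)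

lemma smooth_functions_outside: "f \<in> smooth_functions M \<Longrightarrow> x \<notin> M \<Longrightarrow> f x = 0"
  by (simp add: smooth_functions_def)

text \<open>Local extensions are combined on the intersection of their domains;
  \<open>op 0 0 = 0\<close> respects the convention of extension by zero.\<close>

lemma smooth_functions_combine:
  fixes M :: "'a::euclidean_space set"
  assumes f: "f \<in> smooth_functions M" and g: "g \<in> smooth_functions M"
    and op: "op 0 0 = (0::real)"
    and sm: "\<And>U F G :: 'a \<Rightarrow> real. open U \<Longrightarrow> smooth_on U F \<Longrightarrow> smooth_on U G \<Longrightarrow> smooth_on U (\<lambda>x. op (F x) (G x))"
  shows "(\<lambda>x. op (f x) (g x)) \<in> smooth_functions M"
proof (rule smooth_functionsI)
  show "op (f x) (g x) = 0" if "x \<notin> M" for x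
    using that f g op by (simp add: smooth_functions_outside)
  fix p assume p: "p \<in> M"
  obtain U F where F: "open U" "p \<in> U" "smooth_on U F" "\<And>x. x \<in> U \<Longrightarrow> x \<in> M \<Longrightarrow> F x = f x"
    by (rule smooth_functionsE[OF f p]) blast
  obtain V G where G: "open V" "p \<in> V" "smooth_on V G" "\<And>x. x \<in> V \<Longrightarrow> x \<in> M \<Longrightarrow> G x = g x"
    by (rule smooth_functionsE[OF g p]) blast
  have "smooth_on (U \<inter> V) (\<lambda>x. op (F x) (G x))"
    using F G by (intro sm smooth_on_subset[OF F(3)] smooth_on_subset[OF G(3)]) auto
  then show "\<exists>U H. open U \<and> p \<in> U \<and> smooth_on U H \<and> (\<forall>x \<in> U \<inter> M. H x = op (f x) (g x))"
    using F G by (intro exI[of _ "U \<inter> V"] exI[of _ "\<lambda>x. op (F x) (G x)"]) auto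
qed

lemma smooth_functions_add:
  "f \<in> smooth_functions M \<Longrightarrow> g \<in> smooth_functions M \<Longrightarrow> (\<lambda>x. f x + g x) \<in> smooth_functions M"
  by (rule smooth_functions_combine[where op = "\<lambda>x y. x + y"]) (simp, simp, simp, rule smooth_on_add)

lemma smooth_functions_diff:
  "f \<in> smooth_functions M \<Longrightarrow> g \<in> smooth_functions M \<Longrightarrow> (\<lambda>x. f x - g x) \<in> smooth_functions M"
  by (rule smooth_functions_combine[where op = "\<lambda>x y. x - y"]) (simp, simp, simp, rule smooth_on_diff)

lemma smooth_functions_mult:
  "f \<in> smooth_functions M \<Longrightarrow> g \<in> smooth_functions M \<Longrightarrow> (\<lambda>x. f x * g x) \<in> smooth_functions M"
  by (rule smooth_functions_combine[where op = "\<lambda>x y. x * y"]) (simp, simp, simp, rule smooth_on_mult)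

lemma smooth_functions_0: "(\<lambda>x. 0) \<in> smooth_functions M"
  by (rule smooth_functionsI) (auto intro!: exI[of _ UNIV] exI[of _ "\<lambda>x. 0"] smooth_on_const)

lemma smooth_functions_sum:
  "(\<And>i. i \<in> I \<Longrightarrow> f i \<in> smooth_functions M) \<Longrightarrow> (\<lambda>x. \<Sum>i\<in>I. f i x) \<in> smooth_functions M"
  by (induction I rule: infinite_finite_induct) (auto intro: smooth_functions_add smooth_functions_0)

text \<open>These serve as test functions: they determine a tangent vector, and their differential
  at a point can be prescribed.\<close>

lemma smooth_functions_inner:
  "(\<lambda>x. if x \<in> M then x \<bullet> a else 0) \<in> smooth_functions M"
  by (rule smooth_functionsI)
    (auto intro!: exI[of _ UNIV] exI[of _ "\<lambda>x. x \<bullet> a"] smooth_on_bounded_linear bounded_linear_inner_left)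

text \<open>Near time 0 the curve lies in both M and U, where f and F agree. So the derivative
  depends on the velocity only, and all extensions give the same value.\<close>

lemma smooth_curve_has_derivative:
  fixes F :: "'a::euclidean_space \<Rightarrow> real"
  assumes U: "open U" "p \<in> U" and F: "smooth_on U F" "\<And>x. x \<in> U \<Longrightarrow> x \<in> M \<Longrightarrow> F x = f x"
    and \<gamma>: "smooth_curve_with_velocity M p v \<gamma>"
  shows "((\<lambda>t. f (\<gamma> t)) has_real_derivative frechet_derivative F (at p) v) (at 0)"
proof -
  obtain e where e: "e > 0" "smooth_on {-e<..<e} \<gamma>" "\<gamma> ` {-e<..<e} \<subseteq> M" "\<gamma> 0 = p"
    "(\<gamma> has_vector_derivative v) (at 0)"
    using \<gamma> by (auto simp: smooth_curve_with_velocity_def)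
  have "continuous_on {-e<..<e} \<gamma>"
    using smooth_on_Ck[OF e(2), of 0] by simp
  then have o: "open ({-e<..<e} \<inter> \<gamma> -` U)"
    using U(1) by (intro continuous_open_preimage) auto
  have Fp: "(F has_derivative frechet_derivative F (at p)) (at p)"
    by (rule smooth_on_has_derivative[OF F(1) U(2)])
  have "((\<lambda>t. F (\<gamma> t)) has_derivative (\<lambda>h. frechet_derivative F (at p) (h *\<^sub>R v))) (at 0)"
    using has_derivative_compose[of \<gamma> "\<lambda>h. h *\<^sub>R v" 0 UNIV F] e(4,5) Fp
    by (simp add: has_vector_derivative_def)
  then have "((\<lambda>t. F (\<gamma> t)) has_real_derivative frechet_derivative F (at p) v) (at 0)"
    using linear_scale[OF has_derivative_linear[OF Fp]]
    by (simp add: has_field_derivative_def mult_commute_abs)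
  then show ?thesis
    by (rule has_field_derivative_transform_within_open[OF _ o]) (use e U F(2) in \<open>auto simp: image_subset_iff\<close>)
qed

text \<open>Differentiating along the orbit avoids the choice of an extension. Orbits of points off
  the manifold stay off it, so a smooth function gets the value 0 there, as the extension by zero
  demands.\<close>

definition torus_deriv ::
    "complex ^ 'm ^ 'n \<Rightarrow> complex ^ 'm \<Rightarrow> (complex ^ 'n \<Rightarrow> real) \<Rightarrow> complex ^ 'n \<Rightarrow> real" where
  "torus_deriv \<Lambda> u f p = vector_derivative (\<lambda>t. f (torus_act \<Lambda> (t *\<^sub>R u) p)) (at 0)"

lemma torus_derivI:
  "((\<lambda>t. f (torus_act \<Lambda> (t *\<^sub>R u) p)) has_real_derivative D) (at 0) \<Longrightarrow> torus_deriv \<Lambda> u f p = D"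
  unfolding torus_deriv_def has_real_derivative_iff_has_vector_derivative by (rule vector_derivative_at)

context
  fixes \<Lambda> :: "complex ^ 'm::finite ^ 'n::finite" and M
  defines "M \<equiv> moment_angle_manifold \<Lambda>"
begin

lemma torus_deriv_extension:
  assumes "open U" "p \<in> U" "smooth_on U F" "\<And>x. x \<in> U \<Longrightarrow> x \<in> M \<Longrightarrow> F x = f x" "p \<in> M"
  shows "torus_deriv \<Lambda> u f p = frechet_derivative F (at p) (torus_field \<Lambda> u p)"
  using torus_act_smooth_curve[of p \<Lambda> \<Lambda> u] assms(5)
  by (intro torus_derivI smooth_curve_has_derivative[OF assms(1-4)]) (auto simp: M_def)

text \<open>Including the points off the manifold frees the derivation rules below from a condition
  on p.\<close>

lemma torus_deriv_has_real_derivative: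
  assumes f: "f \<in> smooth_functions M"
  shows "((\<lambda>t. f (torus_act \<Lambda> (t *\<^sub>R u) p)) has_real_derivative torus_deriv \<Lambda> u f p) (at 0)"
proof (cases "p \<in> M")
  case True
  obtain U F where F: "open U" "p \<in> U" "smooth_on U F" "\<And>x. x \<in> U \<Longrightarrow> x \<in> M \<Longrightarrow> F x = f x"
    by (rule smooth_functionsE[OF f True]) blast
  show ?thesis
    using torus_act_smooth_curve[of p \<Lambda> \<Lambda> u] True
    by (subst torus_deriv_extension[OF F True]) (auto simp: M_def intro!: smooth_curve_has_derivative[OF F])
next
  case False
  then have "(\<lambda>t. f (torus_act \<Lambda> (t *\<^sub>R u) p)) = (\<lambda>t. 0)"
    using smooth_functions_outside[OF f] by (auto simp: M_def)
  then show ?thesis by (simp add: torus_deriv_def)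
qed

lemma torus_deriv_add:
  assumes "f \<in> smooth_functions M" "g \<in> smooth_functions M"
  shows "torus_deriv \<Lambda> u (\<lambda>x. f x + g x) p = torus_deriv \<Lambda> u f p + torus_deriv \<Lambda> u g p"
  by (intro torus_derivI DERIV_add torus_deriv_has_real_derivative assms)

lemma torus_deriv_diff:
  assumes "f \<in> smooth_functions M" "g \<in> smooth_functions M"
  shows "torus_deriv \<Lambda> u (\<lambda>x. f x - g x) p = torus_deriv \<Lambda> u f p - torus_deriv \<Lambda> u g p"
  by (intro torus_derivI DERIV_diff torus_deriv_has_real_derivative assms)

lemma torus_deriv_cmult:
  assumes "f \<in> smooth_functions M"
  shows "torus_deriv \<Lambda> u (\<lambda>x. c * f x) p = c * torus_deriv \<Lambda> u f p"
  by (intro torus_derivI DERIV_cmult torus_deriv_has_real_derivative assms)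

lemma torus_deriv_mult:
  assumes "f \<in> smooth_functions M" "g \<in> smooth_functions M"
  shows "torus_deriv \<Lambda> u (\<lambda>x. f x * g x) p = torus_deriv \<Lambda> u f p * g p + f p * torus_deriv \<Lambda> u g p"
  using DERIV_mult[OF torus_deriv_has_real_derivative[OF assms(1)] torus_deriv_has_real_derivative[OF assms(2)]]
  by (intro torus_derivI) (simp add: algebra_simps)

lemma torus_deriv_sum:
  assumes "\<And>i. i \<in> I \<Longrightarrow> f i \<in> smooth_functions M"
  shows "torus_deriv \<Lambda> u (\<lambda>x. \<Sum>i\<in>I. f i x) p = (\<Sum>i\<in>I. torus_deriv \<Lambda> u (f i) p)"
  by (intro torus_derivI DERIV_sum torus_deriv_has_real_derivative assms)

lemma torus_deriv_smooth:
  assumes f: "f \<in> smooth_functions M"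
  shows "torus_deriv \<Lambda> u f \<in> smooth_functions M"
proof (rule smooth_functionsI)
  show "torus_deriv \<Lambda> u f x = 0" if "x \<notin> M" for x
    by (rule torus_derivI) (use that smooth_functions_outside[OF f] in \<open>simp add: M_def\<close>)
  fix p assume p: "p \<in> M"
  obtain U F where F: "open U" "p \<in> U" "smooth_on U F" "\<And>x. x \<in> U \<Longrightarrow> x \<in> M \<Longrightarrow> F x = f x"
    by (rule smooth_functionsE[OF f p]) blast
  have "smooth_on U (\<lambda>q. frechet_derivative F (at q) (torus_field \<Lambda> u q))"
    by (intro smooth_on_frechet_derivative smooth_on_bounded_linear bounded_linear_torus_field F)
  moreover have "frechet_derivative F (at x) (torus_field \<Lambda> u x) = torus_deriv \<Lambda> u f x" if "x \<in> U \<inter> M" for x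
    using torus_deriv_extension[OF F(1) _ F(3,4), of x] that by simp
  ultimately show "\<exists>U F. open U \<and> p \<in> U \<and> smooth_on U F \<and> (\<forall>x \<in> U \<inter> M. F x = torus_deriv \<Lambda> u f x)"
    using F by blast
qed

end

text \<open>Point and direction of differentiation move together; along \<open>Basis\<close> this
  becomes the product rule for scalar functions. The second derivative appears with its direction
  frozen at \<open>L p\<close>, the form to which its symmetry applies.\<close>

lemma frechet_derivative_along_has_derivative:
  fixes F :: "'a::euclidean_space \<Rightarrow> real"
  assumes U: "open U" "p \<in> U" and F: "smooth_on U F" and L: "bounded_linear L"
  shows "((\<lambda>q. frechet_derivative F (at q) (L q)) has_derivative
    (\<lambda>w. frechet_derivative F (at p) (L w) + frechet_derivative (\<lambda>q. frechet_derivative F (at q) (L p)) (at p) w)) (at p)"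
proof -
  have lin: "linear (frechet_derivative F (at q))" if "q \<in> U" for q
    by (rule has_derivative_linear[OF smooth_on_has_derivative[OF F that]])
  have expand: "frechet_derivative F (at q) v = (\<Sum>b\<in>Basis. (v \<bullet> b) * frechet_derivative F (at q) b)"
    if "q \<in> U" for q v
    using linear_sum[OF lin[OF that], of "\<lambda>b. (v \<bullet> b) *\<^sub>R b" Basis] linear_scale[OF lin[OF that]]
    by (simp add: euclidean_representation)
  define F2 where "F2 b = frechet_derivative (\<lambda>q. frechet_derivative F (at q) b) (at p)" for b
  have F2: "((\<lambda>q. frechet_derivative F (at q) b) has_derivative F2 b) (at p)" for b
    unfolding F2_def
    by (intro smooth_on_has_derivative[OF _ U(2)] smooth_on_frechet_derivative smooth_on_const U F)
  have "((\<lambda>q. \<Sum>b\<in>Basis. (v \<bullet> b) * frechet_derivative F (at q) b) has_derivative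
      (\<lambda>w. \<Sum>b\<in>Basis. (v \<bullet> b) * F2 b w)) (at p)" for v
    by (intro has_derivative_sum has_derivative_mult_right F2)
  then have "((\<lambda>q. frechet_derivative F (at q) v) has_derivative (\<lambda>w. \<Sum>b\<in>Basis. (v \<bullet> b) * F2 b w)) (at p)" for v
    by (rule has_derivative_transform_within_open[OF _ U]) (simp add: expand[symmetric])
  \<comment> \<open>Uniqueness of derivatives makes the second derivative linear in the direction
    taken first, too.\<close>
  then have F2v: "F2 v = (\<lambda>w. \<Sum>b\<in>Basis. (v \<bullet> b) * F2 b w)" for v
    using F2 has_derivative_unique by blast
  have "((\<lambda>q. L q \<bullet> b) has_derivative (\<lambda>w. L w \<bullet> b)) (at p)" for b
    by (intro has_derivative_inner_left bounded_linear_imp_has_derivative L)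
  then have "((\<lambda>q. \<Sum>b\<in>Basis. (L q \<bullet> b) * frechet_derivative F (at q) b) has_derivative
      (\<lambda>w. \<Sum>b\<in>Basis. (L p \<bullet> b) * F2 b w + (L w \<bullet> b) * frechet_derivative F (at p) b)) (at p)"
    by (intro has_derivative_sum has_derivative_mult F2)
  moreover have "(\<lambda>w. \<Sum>b\<in>Basis. (L p \<bullet> b) * F2 b w + (L w \<bullet> b) * frechet_derivative F (at p) b)
      = (\<lambda>w. frechet_derivative F (at p) (L w) + F2 (L p) w)"
    unfolding expand[OF U(2), of "L _"] F2v[of "L p"] by (simp add: sum.distrib add.commute)
  ultimately have "((\<lambda>q. \<Sum>b\<in>Basis. (L q \<bullet> b) * frechet_derivative F (at q) b) has_derivative
      (\<lambda>w. frechet_derivative F (at p) (L w) + F2 (L p) w)) (at p)"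
    by simp
  then show ?thesis unfolding F2_def
    by (rule has_derivative_transform_within_open[OF _ U]) (simp add: expand[symmetric])
qed

text \<open>On the manifold, each side is a second derivative of a local extension plus its first
  derivative along an iterated field. The former is symmetric by Schwarz's theorem, the latter
  because the fields are commuting diagonal linear maps.\<close>

lemma torus_deriv_commute:
  fixes \<Lambda> :: "complex ^ 'm::finite ^ 'n::finite"
  assumes f: "f \<in> smooth_functions (moment_angle_manifold \<Lambda>)"
  shows "torus_deriv \<Lambda> u (torus_deriv \<Lambda> v f) p = torus_deriv \<Lambda> v (torus_deriv \<Lambda> u f) p"
proof (cases "p \<in> moment_angle_manifold \<Lambda>")
  case True
  let ?M = "moment_angle_manifold \<Lambda>"
  obtain U F where F: "open U" "p \<in> U" "smooth_on U F" "\<And>x. x \<in> U \<Longrightarrow> x \<in> ?M \<Longrightarrow> F x = f x"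
    by (rule smooth_functionsE[OF f True]) blast
  have *: "torus_deriv \<Lambda> u (torus_deriv \<Lambda> v f) p =
      frechet_derivative F (at p) (torus_field \<Lambda> v (torus_field \<Lambda> u p)) +
      frechet_derivative (\<lambda>q. frechet_derivative F (at q) (torus_field \<Lambda> v p)) (at p) (torus_field \<Lambda> u p)" for u v
  proof -
    have "smooth_on U (\<lambda>q. frechet_derivative F (at q) (torus_field \<Lambda> v q))"
      by (intro smooth_on_frechet_derivative smooth_on_bounded_linear bounded_linear_torus_field F)
    moreover have "frechet_derivative F (at x) (torus_field \<Lambda> v x) = torus_deriv \<Lambda> v f x" if "x \<in> U" "x \<in> ?M" for x
      using torus_deriv_extension[OF F(1) that(1) F(3,4) that(2)] by simp
    ultimately have "torus_deriv \<Lambda> u (torus_deriv \<Lambda> v f) p =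
        frechet_derivative (\<lambda>q. frechet_derivative F (at q) (torus_field \<Lambda> v q)) (at p) (torus_field \<Lambda> u p)"
      by (intro torus_deriv_extension[OF F(1,2)] True)
    then show ?thesis
      using fun_cong[OF frechet_derivative_at[OF frechet_derivative_along_has_derivative[OF F(1-3)
            bounded_linear_torus_field[of \<Lambda> v]]], of "torus_field \<Lambda> u p"]
      by simp
  qed
  show ?thesis unfolding *
    using frechet_derivative_symmetric[OF F(1,2) smooth_on_Ck[OF F(3)], of "torus_field \<Lambda> u p" "torus_field \<Lambda> v p"]
    by (simp add: torus_field_commute[of \<Lambda> v u])
next
  case False
  then show ?thesis using torus_deriv_smooth smooth_functions_outside f by metis
qed

section \<open>The Poisson structure\<close>

definition torus_bracket ::
    "complex ^ 'm::finite ^ 'n \<Rightarrow> (complex ^ 'n \<Rightarrow> real) \<Rightarrow> (complex ^ 'n \<Rightarrow> real) \<Rightarrow> complex ^ 'n \<Rightarrow> real" where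
  "torus_bracket \<Lambda> f g x =
    (\<Sum>k\<in>UNIV. torus_deriv \<Lambda> (axis k 1) f x * torus_deriv \<Lambda> (axis k \<i>) g x
           - torus_deriv \<Lambda> (axis k \<i>) f x * torus_deriv \<Lambda> (axis k 1) g x)"

text \<open>The Leibniz rule leaves a polynomial in first and second derivatives, whose terms cancel
  once the derivations are put in one order. The symmetrization in k and l is essential, as one
  cyclic sum alone need not vanish; the identity says that two bivectors have zero Schouten
  bracket.\<close>

lemma commuting_derivations_jacobi:
  fixes \<Lambda> :: "complex ^ 'm::finite ^ 'n::finite" and a b :: "'k \<Rightarrow> complex ^ 'm"
  defines "D \<equiv> torus_deriv \<Lambda>"
  defines "E k f g \<equiv> \<lambda>x. D (a k) f x * D (b k) g x - D (b k) f x * D (a k) g x"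
  assumes f: "f \<in> smooth_functions (moment_angle_manifold \<Lambda>)"
    and g: "g \<in> smooth_functions (moment_angle_manifold \<Lambda>)"
    and h: "h \<in> smooth_functions (moment_angle_manifold \<Lambda>)"
  shows "E k f (E l g h) x + E k g (E l h f) x + E k h (E l f g) x
    + (E l f (E k g h) x + E l g (E k h f) x + E l h (E k f g) x) = 0"
proof -
  let ?A = "smooth_functions (moment_angle_manifold \<Lambda>)"
  have sm: "D u p \<in> ?A" if "p \<in> ?A" for u p
    using that unfolding D_def by (rule torus_deriv_smooth)
  have DE: "D u (E l p q) x = D u (D (a l) p) x * D (b l) q x + D (a l) p x * D u (D (b l) q) x
      - (D u (D (b l) p) x * D (a l) q x + D (b l) p x * D u (D (a l) q) x)"
    if "p \<in> ?A" "q \<in> ?A" for u l p q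
    using that unfolding E_def D_def
    by (simp add: torus_deriv_diff torus_deriv_mult smooth_functions_mult torus_deriv_smooth)
  \<comment> \<open>Read from left to right, the rules move a outside b and, within one family,
    index k outside index l.\<close>
  have comm: "D (a l) (D (a k) p) x = D (a k) (D (a l) p) x"
      "D (b l) (D (b k) p) x = D (b k) (D (b l) p) x"
      "D (b l) (D (a k) p) x = D (a k) (D (b l) p) x"
      "D (b k) (D (a l) p) x = D (a l) (D (b k) p) x"
      "D (b l) (D (a l) p) x = D (a l) (D (b l) p) x"
      "D (b k) (D (a k) p) x = D (a k) (D (b k) p) x"
    if "p \<in> ?A" for p
    using torus_deriv_commute[OF that] unfolding D_def by metis+
  have E: "E k p q x = D (a k) p x * D (b k) q x - D (b k) p x * D (a k) q x" for k p q
    by (simp add: E_def)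
  show ?thesis
    unfolding E[of _ _ "E _ _ _"] DE[OF f g] DE[OF g h] DE[OF h f] comm[OF f] comm[OF g] comm[OF h]
    by algebra
qed

lemma torus_bracket_smooth:
  assumes "f \<in> smooth_functions (moment_angle_manifold \<Lambda>)" "g \<in> smooth_functions (moment_angle_manifold \<Lambda>)"
  shows "torus_bracket \<Lambda> f g \<in> smooth_functions (moment_angle_manifold \<Lambda>)"
  unfolding torus_bracket_def[abs_def]
  by (intro smooth_functions_sum smooth_functions_diff smooth_functions_mult torus_deriv_smooth assms)

text \<open>The left-hand side is the double sum of \<open>J k l\<close>. Adding the same sum with k
  and l exchanged doubles it and produces pairs that vanish.\<close>

lemma torus_bracket_jacobi:
  fixes \<Lambda> :: "complex ^ 'm::finite ^ 'n::finite"
  assumes f: "f \<in> smooth_functions (moment_angle_manifold \<Lambda>)"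
    and g: "g \<in> smooth_functions (moment_angle_manifold \<Lambda>)"
    and h: "h \<in> smooth_functions (moment_angle_manifold \<Lambda>)"
  shows "torus_bracket \<Lambda> f (torus_bracket \<Lambda> g h) x + torus_bracket \<Lambda> g (torus_bracket \<Lambda> h f) x
    + torus_bracket \<Lambda> h (torus_bracket \<Lambda> f g) x = 0"
proof -
  let ?A = "smooth_functions (moment_angle_manifold \<Lambda>)"
  define E :: "'m \<Rightarrow> _" where "E = (\<lambda>k f g x. torus_deriv \<Lambda> (axis k 1) f x * torus_deriv \<Lambda> (axis k \<i>) g x
           - torus_deriv \<Lambda> (axis k \<i>) f x * torus_deriv \<Lambda> (axis k 1) g x)"
  have B: "torus_bracket \<Lambda> p q = (\<lambda>x. \<Sum>k\<in>UNIV. E k p q x)" for p q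
    by (simp add: E_def torus_bracket_def fun_eq_iff)
  have BB: "torus_bracket \<Lambda> p (torus_bracket \<Lambda> q r) x = (\<Sum>k\<in>UNIV. \<Sum>l\<in>UNIV. E k p (E l q r) x)"
    if "q \<in> ?A" "r \<in> ?A" for p q r
  proof -
    have "torus_deriv \<Lambda> u (\<lambda>x. \<Sum>l\<in>UNIV. E l q r x) x = (\<Sum>l\<in>UNIV. torus_deriv \<Lambda> u (E l q r) x)" for u
      unfolding E_def
      by (intro torus_deriv_sum smooth_functions_diff smooth_functions_mult torus_deriv_smooth that)
    then show ?thesis
      unfolding B[of p] B[of q] E_def[THEN fun_cong, THEN fun_cong, of _ p]
      by (simp add: sum_distrib_left sum_subtractf)
  qed
  define J where "J k l = E k f (E l g h) x + E k g (E l h f) x + E k h (E l f g) x" for k l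
  have "J k l + J l k = 0" for k l
    unfolding J_def E_def using commuting_derivations_jacobi[OF f g h, where a = "\<lambda>k. axis k 1" and b = "\<lambda>k. axis k \<i>" and k = k and l = l and x = x]
    by simp
  then have "(\<Sum>k\<in>UNIV. \<Sum>l\<in>UNIV. J k l) + (\<Sum>k\<in>UNIV. \<Sum>l\<in>UNIV. J l k) = 0"
    by (simp flip: sum.distrib)
  moreover have "(\<Sum>k\<in>UNIV. \<Sum>l\<in>UNIV. J l k) = (\<Sum>k\<in>UNIV. \<Sum>l\<in>UNIV. J k l)"
    by (rule sum.swap)
  ultimately have "(\<Sum>k\<in>UNIV. \<Sum>l\<in>UNIV. J k l) = 0" by simp
  then show ?thesis
    by (simp add: BB f g h J_def sum.distrib)
qed

lemma poisson_structure_torus_bracket: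
  fixes \<Lambda> :: "complex ^ 'm::finite ^ 'n::finite"
  shows "poisson_structure (moment_angle_manifold \<Lambda>) (torus_bracket \<Lambda>)"
proof -
  let ?A = "smooth_functions (moment_angle_manifold \<Lambda>)"
  have cm: "(\<lambda>x. c * p x) \<in> ?A" if "p \<in> ?A" for c p
    by (rule smooth_functions_combine[OF that that, of "\<lambda>x y. c * x"])
      (simp, intro smooth_on_mult smooth_on_const)
  have lin: "torus_bracket \<Lambda> (\<lambda>x. a * f x + b * g x) h = (\<lambda>x. a * torus_bracket \<Lambda> f h x + b * torus_bracket \<Lambda> g h x)"
    if "f \<in> ?A" "g \<in> ?A" for f g h a b
    by (simp add: torus_bracket_def fun_eq_iff torus_deriv_add torus_deriv_cmult cm that sum_distrib_left
        algebra_simps flip: sum.distrib)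
  have anti: "torus_bracket \<Lambda> f g = (\<lambda>x. - torus_bracket \<Lambda> g f x)" for f g
    by (simp add: torus_bracket_def fun_eq_iff algebra_simps flip: sum_negf)
  have leibniz: "torus_bracket \<Lambda> f (\<lambda>x. g x * h x) = (\<lambda>x. torus_bracket \<Lambda> f g x * h x + g x * torus_bracket \<Lambda> f h x)"
    if "g \<in> ?A" "h \<in> ?A" for f g h
    by (simp add: torus_bracket_def fun_eq_iff torus_deriv_mult that sum_distrib_left sum_distrib_right
        algebra_simps flip: sum.distrib)
  show ?thesis
    unfolding poisson_structure_def
    by (intro conjI ballI allI torus_bracket_smooth lin leibniz ext torus_bracket_jacobi)
      (assumption | rule anti[THEN fun_cong])+
qed

section \<open>The characteristic distribution\<close>

text \<open>The Hamiltonian vector of f is the field of \<open>w f\<close>, the contraction of the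
  differential of f with the Poisson tensor; it is unique because linear test functions separate
  vectors. Every u occurs as some \<open>w f\<close>, since by injectivity the differential can be
  prescribed on the orbit directions.\<close>

lemma characteristic_space_torus_bracket:
  fixes \<Lambda> :: "complex ^ 'm::finite ^ 'n::finite"
  assumes p: "p \<in> moment_angle_manifold \<Lambda>" and inj: "inj (\<lambda>u. torus_field \<Lambda> u p)"
  shows "characteristic_space (moment_angle_manifold \<Lambda>) (torus_bracket \<Lambda>) p = range (\<lambda>u. torus_field \<Lambda> u p)"
proof -
  let ?M = "moment_angle_manifold \<Lambda>" and ?X = "\<lambda>u. torus_field \<Lambda> u p"
  define w where "w f = (\<Sum>k\<in>UNIV. torus_deriv \<Lambda> (axis k 1) f p *\<^sub>R (axis k \<i> :: complex ^ 'm)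
      - torus_deriv \<Lambda> (axis k \<i>) f p *\<^sub>R axis k 1)" for f
  have B: "torus_bracket \<Lambda> f g p = frechet_derivative G (at p) (?X (w f))"
    if G: "open U" "p \<in> U" "smooth_on U G" "\<And>x. x \<in> U \<Longrightarrow> x \<in> ?M \<Longrightarrow> G x = g x" for f g U G
  proof -
    have lin: "linear (frechet_derivative G (at p))"
      by (rule has_derivative_linear[OF smooth_on_has_derivative[OF G(3,2)]])
    show ?thesis
      by (simp add: torus_bracket_def w_def torus_deriv_extension[OF G p]
          linear_sum[OF linear_torus_field] linear_diff[OF linear_torus_field] linear_scale[OF linear_torus_field]
          linear_sum[OF lin] linear_diff[OF lin] linear_scale[OF lin])
  qed
  have ham: "is_hamiltonian_vector ?M (torus_bracket \<Lambda>) f p (?X (w f))" for f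
    unfolding is_hamiltonian_vector_def
  proof (intro conjI ballI allI impI)
    show "?X (w f) \<in> tangent_space ?M p"
      using torus_act_smooth_curve[OF p] by (auto simp: tangent_space_def)
    fix g \<gamma> assume g: "g \<in> smooth_functions ?M" and \<gamma>: "smooth_curve_with_velocity ?M p (?X (w f)) \<gamma>"
    obtain U G where G: "open U" "p \<in> U" "smooth_on U G" "\<And>x. x \<in> U \<Longrightarrow> x \<in> ?M \<Longrightarrow> G x = g x"
      by (rule smooth_functionsE[OF g p]) blast
    show "((\<lambda>t. g (\<gamma> t)) has_real_derivative torus_bracket \<Lambda> f g p) (at 0)"
      using smooth_curve_has_derivative[OF G \<gamma>] B[OF G, of f] by simp
  qed
  have lin_fun: "frechet_derivative (\<lambda>x. x \<bullet> a) (at p) v = v \<bullet> a" for a v :: "complex ^ 'n"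
    using frechet_derivative_at[OF bounded_linear_imp_has_derivative[OF bounded_linear_inner_left[of a]], of p]
    by metis
  have uniq: "v = ?X (w f)" if v: "is_hamiltonian_vector ?M (torus_bracket \<Lambda>) f p v" for f v
  proof -
    obtain \<gamma> where \<gamma>: "smooth_curve_with_velocity ?M p v \<gamma>"
      using v by (auto simp: is_hamiltonian_vector_def tangent_space_def)
    have "v \<bullet> a = ?X (w f) \<bullet> a" for a
    proof -
      let ?g = "\<lambda>x. if x \<in> ?M then x \<bullet> a else 0"
      have G: "open UNIV" "p \<in> UNIV" "smooth_on UNIV (\<lambda>x. x \<bullet> a)" "\<And>x. x \<in> UNIV \<Longrightarrow> x \<in> ?M \<Longrightarrow> x \<bullet> a = ?g x"
        by (auto intro: smooth_on_bounded_linear bounded_linear_inner_left)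
      have "((\<lambda>t. ?g (\<gamma> t)) has_real_derivative torus_bracket \<Lambda> f ?g p) (at 0)"
        by (rule v[unfolded is_hamiltonian_vector_def, THEN conjunct2, rule_format, OF smooth_functions_inner \<gamma>])
      from DERIV_unique[OF this smooth_curve_has_derivative[OF G \<gamma>]] show ?thesis
        using B[OF G, of f] by (simp add: lin_fun)
    qed
    then show ?thesis using vector_eq_rdot by blast
  qed
  have "?X u \<in> characteristic_space ?M (torus_bracket \<Lambda>) p" for u
  proof -
    obtain L where L: "linear L" "L \<circ> ?X = id"
      using linear_injective_left_inverse[OF linear_torus_field inj] by blast
    \<comment> \<open>The left inverse L lets a linear function have derivative
      \<open>v \<bullet> c\<close> along the field of every v. Its \<open>w\<close> is then \<i>
      times c, which explains the factor \<open>- \<i>\<close>.\<close>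
    define c where "c = (\<chi> k. - \<i> * u $ k)"
    let ?g = "\<lambda>x. if x \<in> ?M then x \<bullet> adjoint L c else 0"
    have G: "open UNIV" "p \<in> UNIV" "smooth_on UNIV (\<lambda>x. x \<bullet> adjoint L c)"
      "\<And>x. x \<in> UNIV \<Longrightarrow> x \<in> ?M \<Longrightarrow> x \<bullet> adjoint L c = ?g x"
      by (auto intro: smooth_on_bounded_linear bounded_linear_inner_left)
    have "torus_deriv \<Lambda> v ?g p = v \<bullet> c" for v
    proof -
      have "torus_deriv \<Lambda> v ?g p = ?X v \<bullet> adjoint L c"
        using torus_deriv_extension[OF G p] by (simp add: lin_fun)
      also have "\<dots> = L (?X v) \<bullet> c"
        using adjoint_works[OF L(1)] by simp
      also have "L (?X v) = v"
        using fun_cong[OF L(2), of v] by simp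
      finally show ?thesis .
    qed
    moreover have "(axis k 1 \<bullet> c) *\<^sub>R axis k \<i> - (axis k \<i> \<bullet> c) *\<^sub>R axis k 1 = axis k (u $ k)" for k
    proof -
      have "axis k 1 \<bullet> c = Im (u $ k)" "axis k \<i> \<bullet> c = - Re (u $ k)"
        by (simp_all add: c_def inner_axis' inner_complex_def)
      then show ?thesis
        by (simp add: vec_eq_iff axis_def complex_eq_iff)
    qed
    ultimately have "w ?g = (\<Sum>k\<in>UNIV. axis k (u $ k))"
      by (simp add: w_def)
    also have "\<dots> = u"
      by (simp add: vec_eq_iff axis_def)
    finally show ?thesis
      using ham[of ?g] smooth_functions_inner unfolding characteristic_space_def by auto
  qed
  then show ?thesis
    using uniq by (auto simp: characteristic_space_def)
qed

section \<open>Weak hyperbolicity\<close>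

text \<open>Lifting \<open>\<Lambda> $ j\<close> to \<open>(\<Lambda> $ j, 1)\<close> merges the
  homogeneous equations and the normalization into one vector equation in real dimension 2m +
  1.\<close>

lemma moment_angle_manifold_iff:
  "Z \<in> moment_angle_manifold \<Lambda> \<longleftrightarrow>
    (\<Sum>j\<in>UNIV. (cmod (Z $ j))\<^sup>2 *\<^sub>R (\<Lambda> $ j, 1::real)) = (0, 1)"
  by (simp add: moment_angle_manifold_def prod_eq_iff fst_sum snd_sum vec_eq_iff
      scaleR_conv_of_real[where 'a = complex] mult.commute)

text \<open>If the lifted vectors of the support did not span, the \<open>\<lambda>\<^sub>j\<close> of the support would lie in a hyperplane
  through \<open>0\<close>, and Caratheodory's theorem in that hyperplane would put \<open>0\<close> into the convex hull of
  only \<open>2m\<close> of them.\<close>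

lemma span_lifted_support:
  fixes \<Lambda> :: "complex ^ 'm::finite ^ 'n::finite"
  assumes card: "CARD('n) > 2 * CARD('m)" and wh: "weakly_hyperbolic \<Lambda>"
    and Z: "Z \<in> moment_angle_manifold \<Lambda>"
  shows "span ((\<lambda>j. (\<Lambda> $ j, 1::real)) ` {j. Z $ j \<noteq> 0}) = UNIV"
proof (rule ccontr)
  let ?S = "{j. Z $ j \<noteq> 0}"
  assume "span ((\<lambda>j. (\<Lambda> $ j, 1::real)) ` ?S) \<noteq> UNIV"
  then obtain a where a: "a \<noteq> 0" "\<And>x. x \<in> span ((\<lambda>j. (\<Lambda> $ j, 1::real)) ` ?S) \<Longrightarrow> a \<bullet> x = 0"
    using span_not_UNIV_orthogonal by blast
  have aj: "fst a \<bullet> \<Lambda> $ j + snd a = 0" if "j \<in> ?S" for j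
    using a(2)[of "(\<Lambda> $ j, 1)"] that span_base[of "(\<Lambda> $ j, 1::real)"] by (auto simp: inner_prod_def)
  have sum_S: "(\<Sum>j\<in>?S. (cmod (Z $ j))\<^sup>2 *\<^sub>R (\<Lambda> $ j, 1::real)) = (0, 1)"
    using Z unfolding moment_angle_manifold_iff by (subst sum.mono_neutral_left[of UNIV]) (auto simp: zero_prod_def)
  \<comment> \<open>The defining equation puts (0, 1) into the span, so the hyperplane containing
    the support vectors passes through 0.\<close>
  have "snd a = a \<bullet> (0, 1)"
    by (simp add: inner_prod_def)
  also have "\<dots> = 0"
    unfolding sum_S[symmetric] by (intro a(2) span_sum span_scale span_base imageI)
  finally have a0: "snd a = 0" .
  with a(1) have "fst a \<noteq> 0" by (simp add: prod_eq_iff)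
  then have "aff_dim {x. fst a \<bullet> x = 0} = DIM(complex ^ 'm) - 1"
    by (rule aff_dim_hyperplane)
  moreover have "aff_dim ((\<lambda>j. \<Lambda> $ j) ` ?S) \<le> aff_dim {x. fst a \<bullet> x = 0}"
    using aj a0 by (intro aff_dim_subset) auto
  \<comment> \<open>Caratheodory's bound, the affine dimension plus one, is thus at most 2m.\<close>
  ultimately have dim: "aff_dim ((\<lambda>j. \<Lambda> $ j) ` ?S) + 1 \<le> 2 * int CARD('m)"
    by (simp add: mult.commute)
  have S1: "(\<Sum>j\<in>?S. (cmod (Z $ j))\<^sup>2) = 1" "(\<Sum>j\<in>?S. (cmod (Z $ j))\<^sup>2 *\<^sub>R \<Lambda> $ j) = 0"
    using sum_S by (simp_all add: prod_eq_iff fst_sum snd_sum)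
  have "(\<Sum>j\<in>?S. (cmod (Z $ j))\<^sup>2 *\<^sub>R \<Lambda> $ j) \<in> convex hull ((\<lambda>j. \<Lambda> $ j) ` ?S)"
    using S1(1) by (intro convex_sum convex_convex_hull hull_inc) auto
  then have "0 \<in> convex hull ((\<lambda>j. \<Lambda> $ j) ` ?S)"
    using S1(2) by simp
  then obtain T where T: "finite T" "T \<subseteq> (\<lambda>j. \<Lambda> $ j) ` ?S" "int (card T) \<le> 2 * int CARD('m)" "0 \<in> convex hull T"
    using dim unfolding caratheodory_aff_dim[of "(\<lambda>j. \<Lambda> $ j) ` ?S"] by fastforce
  \<comment> \<open>Vectors may repeat, so T is traced back to equally many indices. Since n > 2m,
    these can be padded to the exact size that \<open>weakly_hyperbolic\<close> speaks of.\<close>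
  obtain J0 where J0: "J0 \<subseteq> ?S" "inj_on (\<lambda>j. \<Lambda> $ j) J0" "T = (\<lambda>j. \<Lambda> $ j) ` J0"
    using T(2) unfolding subset_image_inj by blast
  have "card J0 \<le> 2 * CARD('m)"
    using T(3) J0 by (simp add: card_image)
  then obtain J where J: "J0 \<subseteq> J" "card J = 2 * CARD('m)"
    using exists_subset_between[of J0 "2 * CARD('m)" UNIV] card by auto
  then have "0 \<in> convex hull ((\<lambda>j. \<Lambda> $ j) ` J)"
    using T(4) J0(3) hull_mono[of T "(\<lambda>j. \<Lambda> $ j) ` J" convex] by blast
  then show False
    using wh J(2) unfolding weakly_hyperbolic_def by blast
qed

text \<open>Such a u makes \<open>(u, 0)\<close> orthogonal to a spanning set. This yields the
  injectivity of both the infinitesimal action and \<open>shift\<close>.\<close>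

lemma lifted_span_separates:
  fixes \<Lambda> :: "complex ^ 'm::finite ^ 'n::finite"
  assumes sp: "span ((\<lambda>j. (\<Lambda> $ j, 1::real)) ` S) = UNIV" and u: "\<And>j. j \<in> S \<Longrightarrow> \<Lambda> $ j \<bullet> u = 0"
  shows "u = 0"
proof -
  have "orthogonal (u, 0::real) y" if "y \<in> (\<lambda>j. (\<Lambda> $ j, 1::real)) ` S" for y
    using that u by (auto simp: orthogonal_def inner_prod_def inner_commute)
  then have "orthogonal (u, 0::real) x" for x
    using orthogonal_to_span[of x "(\<lambda>j. (\<Lambda> $ j, 1::real)) ` S" "(u, 0::real)"]
    unfolding sp by blast
  then have "(u, 0::real) = 0" by (metis orthogonal_self)
  then show "u = 0" by (simp add: zero_prod_def)
qed

text \<open>Where the field of u vanishes, u is orthogonal to all \<open>\<Lambda> $ j\<close> of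
  the support. This is the local freeness of the action.\<close>

lemma inj_torus_field:
  fixes \<Lambda> :: "complex ^ 'm::finite ^ 'n::finite"
  assumes "CARD('n) > 2 * CARD('m)" "weakly_hyperbolic \<Lambda>" "Z \<in> moment_angle_manifold \<Lambda>"
  shows "inj (\<lambda>u. torus_field \<Lambda> u Z)"
proof (rule linear_injective_0[OF linear_torus_field, THEN iffD2], intro allI impI)
  fix u assume "torus_field \<Lambda> u Z = 0"
  then show "u = 0"
    by (intro lifted_span_separates[OF span_lifted_support[OF assms]]) (auto simp: torus_field_def vec_eq_iff)
qed

section \<open>Adapted charts\<close>

lemma smooth_on_Re: "open S \<Longrightarrow> smooth_on S f \<Longrightarrow> smooth_on S (\<lambda>x. Re (f x))"
  by (rule smooth_on_linear_compose[OF _ bounded_linear_Re])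

lemma smooth_on_Im: "open S \<Longrightarrow> smooth_on S f \<Longrightarrow> smooth_on S (\<lambda>x. Im (f x))"
  by (rule smooth_on_linear_compose[OF _ bounded_linear_Im])

lemma smooth_on_of_real: "open S \<Longrightarrow> smooth_on S f \<Longrightarrow> smooth_on S (\<lambda>x. complex_of_real (f x))"
  by (rule smooth_on_linear_compose[OF _ bounded_linear_of_real])

lemma smooth_on_nth: "open S \<Longrightarrow> smooth_on S (\<lambda>x. x $ i)"
  by (rule smooth_on_bounded_linear[OF _ bounded_linear_vec_nth])

lemma smooth_on_cmod_power2:
  assumes "open S" "smooth_on S f"
  shows "smooth_on S (\<lambda>x. (cmod (f x))\<^sup>2)"
  unfolding cmod_power2 unfolding power2_eq_square
  by (intro smooth_on_add smooth_on_mult smooth_on_Re smooth_on_Im assms)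

lemma smooth_on_exp_compose: "open S \<Longrightarrow> smooth_on S f \<Longrightarrow> smooth_on S (\<lambda>x. exp (f x :: complex))"
  using smooth_on_compose[OF _ _ smooth_on_exp] by blast

lemma smooth_on_Ln_compose:
  "open S \<Longrightarrow> smooth_on S f \<Longrightarrow> (\<And>x. x \<in> S \<Longrightarrow> f x \<notin> \<real>\<^sub>\<le>\<^sub>0) \<Longrightarrow> smooth_on S (\<lambda>x. Ln (f x))"
  using smooth_on_compose[OF _ _ smooth_on_Ln] by blast

lemmas smooth_on_intros =
  smooth_on_add smooth_on_diff smooth_on_minus smooth_on_mult smooth_on_sum smooth_on_const
  smooth_on_Re smooth_on_Im smooth_on_of_real smooth_on_nth smooth_on_cmod_power2 smooth_on_exp_compose

text \<open>On this strip Ln inverts exp, whereas the logarithm of a negative number has imaginary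
  part pi. It keeps the values of \<open>Psi\<close> off the branch cuts.\<close>

lemma exp_notin_nonpos_Reals:
  assumes "\<bar>Im z\<bar> < pi"
  shows "exp z \<notin> \<real>\<^sub>\<le>\<^sub>0"
proof
  assume *: "exp z \<in> \<real>\<^sub>\<le>\<^sub>0"
  then have "Re (exp z) \<le> 0" "Im (exp z) = 0"
    by (simp_all only: complex_nonpos_Reals_iff)
  moreover have "exp z \<noteq> 0" by simp
  ultimately have "Re (exp z) < 0 \<and> Im (exp z) = 0"
    by (metis complex_eq_iff order_le_less zero_complex.sel)
  then have "Im (Ln (exp z)) = pi"
    using Im_Ln_eq_pi[of "exp z"] by simp
  then show False using assms by simp
qed

text \<open>The indices in \<open>J\<close> are those of a basis \<open>(\<lambda>\<^sub>j, 1)\<close> of \<open>\<real>\<^sup>2\<^sup>m\<^sup>+\<^sup>1\<close>. In the chart the manifold is given by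
  \<open>Re w\<^sub>j = 0\<close> for \<open>j \<in> J\<close>, and the action of \<open>u\<close> translates \<open>w\<^sub>j\<close>, \<open>j \<in> J\<close>, by
  \<open>\<i> \<langle>\<lambda>\<^sub>j, u\<rangle>\<close> and fixes the other coordinates.\<close>

locale torus_chart =
  fixes \<Lambda> :: "complex ^ 'm::finite ^ 'n::finite" and J :: "'n set"
    and a :: "'n \<Rightarrow> 'n \<Rightarrow> real" and b :: "'n \<Rightarrow> real" and e :: "'n \<Rightarrow> complex"
  assumes a: "k \<notin> J \<Longrightarrow> (\<Lambda> $ k, 1) = (\<Sum>j\<in>J. a k j *\<^sub>R (\<Lambda> $ j, 1::real))"
    and b: "(0, 1) = (\<Sum>j\<in>J. b j *\<^sub>R (\<Lambda> $ j, 1::real))"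
    and independent: "(\<Sum>j\<in>J. c j *\<^sub>R (\<Lambda> $ j, 1::real)) = 0 \<Longrightarrow> j \<in> J \<Longrightarrow> c j = 0"
    and e: "cmod (e j) = 1"
begin

text \<open>Division by the unit number \<open>e j\<close> turns the branch cut of Ln away from the
  base point of the chart.\<close>

definition phase :: "complex ^ 'n \<Rightarrow> 'n \<Rightarrow> real" where
  "phase z j = Im (Ln (z $ j / e j))"

text \<open>The real parts in J are the coordinates of the defining equation in the lifted basis:
  \<open>a l k\<close> and \<open>b k\<close> are those of the other lifted vectors and of (0, 1).
  Outside J the rotation cancels the action, because \<open>\<Lambda> $ k\<close> is the combination
  of basis vectors with coefficients \<open>a k j\<close>.\<close>

definition Phi :: "complex ^ 'n \<Rightarrow> complex ^ 'n" where
  "Phi z = (\<chi> k. if k \<in> J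
     then of_real ((cmod (z $ k))\<^sup>2 + (\<Sum>l\<in>-J. a l k * (cmod (z $ l))\<^sup>2) - b k) + \<i> * of_real (phase z k)
     else z $ k * exp (- (\<i> * of_real (\<Sum>j\<in>J. a k j * phase z j))))"

text \<open>Solves the real part of coordinate j of \<open>Phi\<close> for the squared modulus;
  \<open>Phi\<close> preserves the moduli outside J.\<close>

definition radius2 :: "complex ^ 'n \<Rightarrow> 'n \<Rightarrow> real" where
  "radius2 w j = Re (w $ j) + b j - (\<Sum>l\<in>-J. a l j * (cmod (w $ l))\<^sup>2)"

text \<open>The square root of \<open>radius2\<close> is written as exp of half a logarithm, so that
  smoothness reduces to that of exp and Ln.\<close>

definition Psi :: "complex ^ 'n \<Rightarrow> complex ^ 'n" where
  "Psi w = (\<chi> k. if k \<in> J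
     then e k * exp (Ln (of_real (radius2 w k)) * (1/2) + \<i> * of_real (Im (w $ k)))
     else w $ k * exp (\<i> * of_real (\<Sum>j\<in>J. a k j * Im (w $ j))))"

definition dom :: "(complex ^ 'n) set" where
  "dom = {z. \<forall>j\<in>J. z $ j / e j \<notin> \<real>\<^sub>\<le>\<^sub>0}"

definition cod :: "(complex ^ 'n) set" where
  "cod = {w. \<forall>j\<in>J. 0 < radius2 w j \<and> \<bar>Im (w $ j)\<bar> < pi}"

definition shift :: "complex ^ 'm \<Rightarrow> complex ^ 'n" where
  "shift u = (\<chi> k. if k \<in> J then \<i> * of_real (\<Lambda> $ k \<bullet> u) else 0)"

lemma e_nonzero [simp]: "e j \<noteq> 0"
  using e[of j] by auto

lemma open_dom: "open dom"
proof -
  have "dom = (\<Inter>j\<in>J. (\<lambda>z. z $ j / e j) -` (- \<real>\<^sub>\<le>\<^sub>0))"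
    by (auto simp: dom_def)
  moreover have "open ((\<lambda>z. z $ j / e j) -` (- \<real>\<^sub>\<le>\<^sub>0) :: (complex ^ 'n) set)" for j
    by (intro open_vimage) (auto intro!: continuous_intros simp: open_Compl)
  ultimately show ?thesis by auto
qed

lemma open_cod: "open cod"
proof -
  have "cod = (\<Inter>j\<in>J. {w. 0 < radius2 w j} \<inter> {w. \<bar>Im (w $ j)\<bar> < pi})"
    by (auto simp: cod_def)
  moreover have "open ({w. 0 < radius2 w j} \<inter> {w. \<bar>Im (w $ j)\<bar> < pi})" for j
    unfolding radius2_def by (intro open_Int open_Collect_less continuous_intros)
  ultimately show ?thesis by auto
qed

section \<open>The two chart maps are mutually inverse\<close>

lemma norm_Phi_nth [simp]: "k \<notin> J \<Longrightarrow> cmod (Phi z $ k) = cmod (z $ k)"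
  by (simp add: Phi_def norm_mult)

lemma radius2_Phi: "j \<in> J \<Longrightarrow> radius2 (Phi z) j = (cmod (z $ j))\<^sup>2"
  by (simp add: radius2_def) (simp add: Phi_def)

lemma Phi_in_cod:
  assumes "z \<in> dom"
  shows "Phi z \<in> cod"
  unfolding cod_def
proof (intro CollectI ballI conjI)
  fix j assume j: "j \<in> J"
  then have nz: "z $ j / e j \<notin> \<real>\<^sub>\<le>\<^sub>0"
    using assms by (simp add: dom_def)
  then have "z $ j \<noteq> 0" by auto
  then show "0 < radius2 (Phi z) j" using j by (simp add: radius2_Phi)
  have "z $ j / e j \<noteq> 0" using \<open>z $ j \<noteq> 0\<close> by simp
  then have "- pi < Im (Ln (z $ j / e j))" "Im (Ln (z $ j / e j)) < pi"
    using mpi_less_Im_Ln Im_Ln_less_pi nz by blast+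
  then show "\<bar>Im (Phi z $ j)\<bar> < pi"
    using j by (simp add: Phi_def phase_def)
qed

lemma Psi_Phi:
  assumes "z \<in> dom"
  shows "Psi (Phi z) = z"
  unfolding vec_eq_iff
proof
  fix k
  show "Psi (Phi z) $ k = z $ k"
  proof (cases "k \<in> J")
    case True
    then have nz: "z $ k \<noteq> 0"
      using assms by (auto simp: dom_def)
    have "Ln (of_real ((cmod (z $ k))\<^sup>2)) * (1/2) = of_real (ln (cmod (z $ k)))"
      using nz by (subst Ln_of_real) (auto simp: ln_realpow)
    \<comment> \<open>Having modulus 1, \<open>e k\<close> affects only the imaginary part of the
      logarithm.\<close>
    also have "\<dots> = of_real (Re (Ln (z $ k / e k)))"
      using nz by (simp add: norm_divide e)
    finally have "Ln (of_real (radius2 (Phi z) k)) * (1/2) + \<i> * of_real (Im (Phi z $ k)) = Ln (z $ k / e k)"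
      using True by (simp add: radius2_Phi) (simp add: Phi_def phase_def complex_eq_iff)
    then show ?thesis
      using True nz by (simp add: Psi_def)
  next
    case False
    have "(\<Sum>j\<in>J. a k j * Im (Phi z $ j)) = (\<Sum>j\<in>J. a k j * phase z j)"
      by (intro sum.cong) (auto simp: Phi_def)
    then have "Psi (Phi z) $ k = Phi z $ k * exp (\<i> * of_real (\<Sum>j\<in>J. a k j * phase z j))"
      using False by (simp add: Psi_def)
    also have "\<dots> = z $ k"
      using False by (simp add: Phi_def flip: exp_add)
    finally show ?thesis .
  qed
qed

lemma Psi_nth_divide: "j \<in> J \<Longrightarrow> Psi w $ j / e j = exp (Ln (of_real (radius2 w j)) * (1/2) + \<i> * of_real (Im (w $ j)))"
  by (simp add: Psi_def)

lemma Im_Ln_radius2: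
  assumes "w \<in> cod" "j \<in> J"
  shows "Im (Ln (of_real (radius2 w j)) * (1/2) + \<i> * of_real (Im (w $ j))) = Im (w $ j)"
  using assms by (simp add: cod_def)

lemma Psi_in_dom: "w \<in> cod \<Longrightarrow> Psi w \<in> dom"
  unfolding dom_def using Im_Ln_radius2 exp_notin_nonpos_Reals
  by (simp add: Psi_nth_divide cod_def del: Im_divide_numeral)

lemma phase_Psi: "w \<in> cod \<Longrightarrow> j \<in> J \<Longrightarrow> phase (Psi w) j = Im (w $ j)"
  unfolding phase_def Psi_nth_divide
  by (subst Ln_exp) (auto simp: Im_Ln_radius2 cod_def)

lemma norm_Psi_nth: "w \<in> cod \<Longrightarrow> j \<in> J \<Longrightarrow> (cmod (Psi w $ j))\<^sup>2 = radius2 w j"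
proof -
  assume "w \<in> cod" "j \<in> J"
  then have "0 < radius2 w j" by (simp add: cod_def)
  then have "(exp (ln (radius2 w j) / 2))\<^sup>2 = radius2 w j"
    by (simp flip: exp_double)
  then show ?thesis
    using \<open>0 < radius2 w j\<close> \<open>j \<in> J\<close> by (simp add: Psi_def norm_mult e)
qed

lemma Phi_Psi:
  assumes "w \<in> cod"
  shows "Phi (Psi w) = w"
  unfolding vec_eq_iff
proof
  fix k
  have out: "cmod (Psi w $ l) = cmod (w $ l)" if "l \<notin> J" for l
    using that by (simp add: Psi_def norm_mult)
  show "Phi (Psi w) $ k = w $ k"
  proof (cases "k \<in> J")
    case True
    have "(\<Sum>l\<in>-J. a l k * (cmod (Psi w $ l))\<^sup>2) = (\<Sum>l\<in>-J. a l k * (cmod (w $ l))\<^sup>2)"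
      by (intro sum.cong) (auto simp: out)
    then show ?thesis
      using True by (simp add: Phi_def norm_Psi_nth assms phase_Psi radius2_def complex_eq_iff)
  next
    case False
    have "(\<Sum>j\<in>J. a k j * phase (Psi w) j) = (\<Sum>j\<in>J. a k j * Im (w $ j))"
      by (intro sum.cong) (auto simp: phase_Psi assms)
    then show ?thesis
      using False by (simp add: Phi_def) (simp add: Psi_def flip: exp_add)
  qed
qed

lemma smooth_on_Phi: "smooth_on dom Phi"
proof (rule smooth_on_vec_lambda[OF open_dom])
  fix k
  have ph: "smooth_on dom (\<lambda>z. phase z j)" if "j \<in> J" for j
    unfolding phase_def divide_inverse using that
    by (intro smooth_on_intros smooth_on_Ln_compose open_dom) (auto simp: dom_def divide_inverse)
  show "smooth_on dom (\<lambda>z. Phi z $ k)"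
  proof (cases "k \<in> J")
    case True
    then have "(\<lambda>z. Phi z $ k) = (\<lambda>z. of_real ((cmod (z $ k))\<^sup>2 +
        (\<Sum>l\<in>-J. a l k * (cmod (z $ l))\<^sup>2) - b k) + \<i> * of_real (phase z k))"
      by (simp only: Phi_def vec_lambda_beta if_True)
    then show ?thesis
      using True by (simp only:) (intro smooth_on_intros open_dom ph)
  next
    case False
    then have "(\<lambda>z. Phi z $ k) = (\<lambda>z. z $ k * exp (- (\<i> * of_real (\<Sum>j\<in>J. a k j * phase z j))))"
      by (simp only: Phi_def vec_lambda_beta if_False)
    then show ?thesis
      by (simp only:) (intro smooth_on_intros open_dom ph)
  qed
qed

lemma smooth_on_Psi: "smooth_on cod Psi"
proof (rule smooth_on_vec_lambda[OF open_cod])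
  fix k
  have r: "smooth_on cod (\<lambda>w. Ln (of_real (radius2 w j)))" if "j \<in> J" for j
  proof (rule smooth_on_Ln_compose[OF open_cod])
    show "smooth_on cod (\<lambda>w. complex_of_real (radius2 w j))"
      unfolding radius2_def by (intro smooth_on_intros open_cod)
    show "complex_of_real (radius2 w j) \<notin> \<real>\<^sub>\<le>\<^sub>0" if "w \<in> cod" for w
      using that \<open>j \<in> J\<close> by (auto simp: cod_def complex_nonpos_Reals_iff)
  qed
  show "smooth_on cod (\<lambda>w. Psi w $ k)"
  proof (cases "k \<in> J")
    case True
    then have "(\<lambda>w. Psi w $ k) = (\<lambda>w. e k * exp (Ln (of_real (radius2 w k)) * (1/2) + \<i> * of_real (Im (w $ k))))"
      by (simp only: Psi_def vec_lambda_beta if_True)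
    then show ?thesis
      using True by (simp only:) (intro smooth_on_intros open_cod r)
  next
    case False
    then have "(\<lambda>w. Psi w $ k) = (\<lambda>w. w $ k * exp (\<i> * of_real (\<Sum>j\<in>J. a k j * Im (w $ j))))"
      by (simp only: Psi_def vec_lambda_beta if_False)
    then show ?thesis
      by (simp only:) (intro smooth_on_intros open_cod)
  qed
qed

text \<open>The translation changes only imaginary parts in J, on which \<open>radius2\<close> does
  not depend; so moduli stay and angles add. Outside J the angles combine through the expansion of
  \<open>\<Lambda> $ k\<close>.\<close>

lemma Psi_shift: "Psi (w + shift u) = torus_act \<Lambda> u (Psi w)"
  unfolding vec_eq_iff
proof
  fix k
  show "Psi (w + shift u) $ k = torus_act \<Lambda> u (Psi w) $ k"
  proof (cases "k \<in> J")
    case True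
    have "(\<Sum>l\<in>-J. a l k * (cmod ((w + shift u) $ l))\<^sup>2) = (\<Sum>l\<in>-J. a l k * (cmod (w $ l))\<^sup>2)"
      by (intro sum.cong) (auto simp: shift_def)
    then have "radius2 (w + shift u) k = radius2 w k"
      using True by (simp add: radius2_def) (simp add: shift_def)
    then show ?thesis
      using True by (simp add: Psi_def torus_act_def) (simp add: shift_def exp_add distrib_left mult_ac)
  next
    case False
    have "\<Lambda> $ k = (\<Sum>j\<in>J. a k j *\<^sub>R \<Lambda> $ j)"
      using arg_cong[OF a[OF False], of fst] by (simp add: fst_sum)
    then have "\<Lambda> $ k \<bullet> u = (\<Sum>j\<in>J. a k j * (\<Lambda> $ j \<bullet> u))"
      by (simp add: inner_sum_left)
    moreover have "(\<Sum>j\<in>J. a k j * Im ((w + shift u) $ j)) = (\<Sum>j\<in>J. a k j * Im (w $ j)) + (\<Sum>j\<in>J. a k j * (\<Lambda> $ j \<bullet> u))"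
      by (auto simp: shift_def distrib_left simp flip: sum.distrib intro!: sum.cong)
    ultimately have "(\<Sum>j\<in>J. a k j * Im ((w + shift u) $ j)) = (\<Sum>j\<in>J. a k j * Im (w $ j)) + \<Lambda> $ k \<bullet> u"
      by simp
    moreover have "(w + shift u) $ k = w $ k"
      using False by (simp add: shift_def)
    ultimately show ?thesis
      using False unfolding Psi_def torus_act_def
      by (simp only: vec_lambda_beta if_False of_real_add distrib_left exp_add mult_ac)
  qed
qed

text \<open>The real parts are the coefficients of the defining vector equation in an independent
  family, so all of them vanish exactly when it holds.\<close>

lemma moment_angle_manifold_Phi:
  "z \<in> moment_angle_manifold \<Lambda> \<longleftrightarrow> (\<forall>j\<in>J. Re (Phi z $ j) = 0)"
proof -
  let ?l = "\<lambda>j. (\<Lambda> $ j, 1::real)"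
  have "(\<Sum>j\<in>J. Re (Phi z $ j) *\<^sub>R ?l j) =
      (\<Sum>j\<in>J. (cmod (z $ j))\<^sup>2 *\<^sub>R ?l j + (\<Sum>l\<in>-J. (a l j * (cmod (z $ l))\<^sup>2) *\<^sub>R ?l j) - b j *\<^sub>R ?l j)"
    by (intro sum.cong) (auto simp: Phi_def scaleR_left_distrib scaleR_left_diff_distrib scaleR_sum_left
        simp del: scaleR_Pair)
  also have "\<dots> = (\<Sum>j\<in>J. (cmod (z $ j))\<^sup>2 *\<^sub>R ?l j) + (\<Sum>l\<in>-J. \<Sum>j\<in>J. (a l j * (cmod (z $ l))\<^sup>2) *\<^sub>R ?l j) - (0, 1)"
    unfolding b by (simp add: sum.distrib sum_subtractf sum.swap[of _ "-J" J] del: scaleR_Pair)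
  also have "(\<Sum>l\<in>-J. \<Sum>j\<in>J. (a l j * (cmod (z $ l))\<^sup>2) *\<^sub>R ?l j) = (\<Sum>l\<in>-J. (cmod (z $ l))\<^sup>2 *\<^sub>R ?l l)"
    by (intro sum.cong refl, subst a) (auto simp: scaleR_sum_right mult.commute simp del: scaleR_Pair)
  also have "(\<Sum>j\<in>J. (cmod (z $ j))\<^sup>2 *\<^sub>R ?l j) + \<dots> = (\<Sum>j\<in>UNIV. (cmod (z $ j))\<^sup>2 *\<^sub>R ?l j)"
    by (subst sum.union_disjoint[symmetric]) (auto simp del: scaleR_Pair)
  finally have *: "(\<Sum>j\<in>J. Re (Phi z $ j) *\<^sub>R ?l j) = (\<Sum>j\<in>UNIV. (cmod (z $ j))\<^sup>2 *\<^sub>R ?l j) - (0, 1)" .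
  show ?thesis
  proof
    assume "z \<in> moment_angle_manifold \<Lambda>"
    then have "(\<Sum>j\<in>J. Re (Phi z $ j) *\<^sub>R ?l j) = 0"
      using * by (simp only: moment_angle_manifold_iff diff_self)
    then show "\<forall>j\<in>J. Re (Phi z $ j) = 0"
      using independent[of "\<lambda>j. Re (Phi z $ j)"] by blast
  next
    assume "\<forall>j\<in>J. Re (Phi z $ j) = 0"
    then have "(\<Sum>j\<in>J. Re (Phi z $ j) *\<^sub>R ?l j) = 0" by (simp del: scaleR_Pair)
    then show "z \<in> moment_angle_manifold \<Lambda>"
      using * unfolding moment_angle_manifold_iff by simp
  qed
qed

lemma linear_shift: "linear shift"
  by (intro linearI) (auto simp: shift_def vec_eq_iff inner_add_right distrib_left scaleR_conv_of_real[where 'a = complex])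

end

section \<open>Existence of adapted charts\<close>

lemma independent_image_sum_eq_0:
  fixes f :: "'i \<Rightarrow> 'a::real_vector"
  assumes "finite J" "inj_on f J" "independent (f ` J)" "(\<Sum>j\<in>J. c j *\<^sub>R f j) = 0" "j \<in> J"
  shows "c j = 0"
proof -
  have "(\<Sum>v\<in>f ` J. c (the_inv_into J f v) *\<^sub>R v) = 0"
    using assms(2,4) by (simp add: sum.reindex the_inv_into_f_f)
  then have "c (the_inv_into J f (f j)) = 0"
    using independentD[OF assms(3) _ subset_refl, of "\<lambda>v. c (the_inv_into J f v)" "f j"] assms(1,5)
    by (auto simp: o_def)
  then show ?thesis using assms(2,5) by (simp add: the_inv_into_f_f)
qed

lemma in_span_image_sum:
  fixes f :: "'i \<Rightarrow> 'a::real_vector"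
  assumes "finite J" "inj_on f J" "x \<in> span (f ` J)"
  shows "\<exists>c. x = (\<Sum>j\<in>J. c j *\<^sub>R f j)"
proof -
  obtain u where "x = (\<Sum>v\<in>f ` J. u v *\<^sub>R v)"
    using assms(1,3) span_finite[of "f ` J"] by auto
  then have "x = (\<Sum>j\<in>J. u (f j) *\<^sub>R f j)"
    using assms(2) by (simp add: sum.reindex)
  then show ?thesis by (rule exI[of _ "\<lambda>j. u (f j)"])
qed

text \<open>The basis is picked among the lifted vectors of the support of p, so each coordinate in
  J is nonzero at p and has a phase there.\<close>

lemma torus_chart_exists:
  fixes \<Lambda> :: "complex ^ 'm::finite ^ 'n::finite"
  assumes "CARD('n) > 2 * CARD('m)" "weakly_hyperbolic \<Lambda>" and p: "p \<in> moment_angle_manifold \<Lambda>"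
  obtains J a b e where "torus_chart \<Lambda> J a b e" "p \<in> torus_chart.dom J e" "card J = 2 * CARD('m) + 1"
    "span ((\<lambda>j. (\<Lambda> $ j, 1::real)) ` J) = UNIV"
proof -
  let ?l = "\<lambda>j. (\<Lambda> $ j, 1::real)" and ?S = "{j. p $ j \<noteq> 0}"
  obtain B where B: "B \<subseteq> ?l ` ?S" "independent B" "?l ` ?S \<subseteq> span B" "card B = dim (?l ` ?S)"
    using basis_exists by blast
  obtain J where J: "J \<subseteq> ?S" "inj_on ?l J" "B = ?l ` J"
    using B(1) unfolding subset_image_inj by blast
  have sp: "span (?l ` J) = UNIV"
    using span_mono[OF B(3)] span_lifted_support[OF assms] J(3) by (metis span_span top.extremum_uniqueI)
  have fin: "finite J" by simp
  have "\<forall>k. \<exists>c. ?l k = (\<Sum>j\<in>J. c j *\<^sub>R ?l j)"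
    using in_span_image_sum[OF fin J(2)] sp by blast
  then obtain a where a: "\<And>k. ?l k = (\<Sum>j\<in>J. a k j *\<^sub>R ?l j)"
    using choice[of "\<lambda>k c. ?l k = (\<Sum>j\<in>J. c j *\<^sub>R ?l j)"] by blast
  obtain b where b: "(0, 1) = (\<Sum>j\<in>J. b j *\<^sub>R ?l j)"
    using in_span_image_sum[OF fin J(2), of "(0, 1)"] sp by auto
  \<comment> \<open>This makes \<open>p $ j / e j\<close> a positive real for j in J; the default 1
    keeps modulus 1 at the zero coordinates.\<close>
  define e where "e j = (if p $ j = 0 then 1 else sgn (p $ j))" for j
  have "dim (?l ` ?S) = DIM((complex ^ 'm) \<times> real)"
    using span_lifted_support[OF assms] by (metis dim_UNIV dim_span)
  then have card: "card J = 2 * CARD('m) + 1"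
    using B(4) J(2,3) by (simp add: card_image)
  have chart: "torus_chart \<Lambda> J a b e"
  proof
    show "cmod (e j) = 1" for j
      by (simp add: e_def norm_sgn)
    show "c j = 0" if "(\<Sum>j\<in>J. c j *\<^sub>R ?l j) = 0" "j \<in> J" for c j
      using independent_image_sum_eq_0[OF fin J(2) _ that] B(2) J(3) by blast
  qed (rule a b)+
  moreover have "p \<in> torus_chart.dom J e"
    unfolding torus_chart.dom_def[OF chart]
  proof (intro CollectI ballI)
    fix j assume "j \<in> J"
    then have "p $ j / e j = of_real (cmod (p $ j))" "cmod (p $ j) > 0"
      using J(1) by (auto simp: e_def sgn_eq)
    then show "p $ j / e j \<notin> \<real>\<^sub>\<le>\<^sub>0" by simp
  qed
  ultimately show ?thesis using that card sp by blast
qed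

text \<open>The set is the orthogonal complement of the independent vectors \<open>axis j 1\<close>,
  so each equation costs one real dimension.\<close>

lemma dim_Re_zero:
  fixes J :: "'n::finite set"
  shows "dim {w :: complex ^ 'n. \<forall>j\<in>J. Re (w $ j) = 0} + card J = 2 * CARD('n)"
proof -
  let ?A = "(\<lambda>j. axis j 1 :: complex ^ 'n) ` J"
  have "?A \<subseteq> Basis"
    by (auto simp: Basis_vec_def Basis_complex_def)
  then have ind: "independent ?A"
    using independent_mono independent_Basis by blast
  have "inj_on (\<lambda>j. axis j 1 :: complex ^ 'n) J"
    by (auto simp: inj_on_def axis_eq_axis)
  then have card: "dim (span ?A) = card J"
    using ind by (simp add: dim_eq_card_independent card_image)
  have "{w :: complex ^ 'n. \<forall>j\<in>J. Re (w $ j) = 0} = {w \<in> UNIV. \<forall>x\<in>span ?A. orthogonal x w}"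
  proof (intro set_eqI iffI; clarsimp)
    fix w x assume "\<forall>j\<in>J. Re (w $ j) = 0" "x \<in> span ?A"
    then show "orthogonal x w"
      by (subst orthogonal_commute, intro orthogonal_to_span[of x ?A w])
        (auto simp: orthogonal_def inner_axis inner_complex_def)
next
    fix w :: "complex ^ 'n" and j
    assume "\<forall>x\<in>span ?A. orthogonal x w" "j \<in> J"
    then have "orthogonal (axis j 1) w" by (simp add: span_base)
    then show "Re (w $ j) = 0" by (simp add: orthogonal_def inner_axis' inner_complex_def)
  qed
  then show ?thesis
    using dim_subspace_orthogonal_to_vectors[of "span ?A" UNIV] card by (simp add: mult.commute)
qed

text \<open>Gathers what the leaves require of a chart. V is shrunk to a ball, because convexity
  will make its slices connected.\<close>

lemma adapted_chart_exists:
  fixes \<Lambda> :: "complex ^ 'm::finite ^ 'n::finite"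
  assumes n: "CARD('n) > 2 * CARD('m)" and wh: "weakly_hyperbolic \<Lambda>"
    and p: "p \<in> moment_angle_manifold \<Lambda>"
  obtains U V \<Phi> \<Psi> T s where "p \<in> U" "open U" "open (V :: (complex ^ 'n) set)" "convex V" "homeomorphism U V \<Phi> \<Psi>"
    "smooth_on U \<Phi>" "smooth_on V \<Psi>" "subspace T" "dim T = 2 * CARD('n) - 2 * CARD('m) - 1"
    "\<Phi> ` (U \<inter> moment_angle_manifold \<Lambda>) = V \<inter> T" "linear s" "inj s" "range s \<subseteq> T"
    "\<forall>w u. \<Psi> (w + s u) = torus_act \<Lambda> u (\<Psi> w)"
proof -
  obtain J a b e where chart: "torus_chart \<Lambda> J a b e" and pd: "p \<in> torus_chart.dom J e"
    and card: "card J = 2 * CARD('m) + 1" and sp: "span ((\<lambda>j. (\<Lambda> $ j, 1::real)) ` J) = UNIV"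
    by (rule torus_chart_exists[OF assms])
  interpret torus_chart \<Lambda> J a b e by (rule chart)
  obtain r where r: "r > 0" "ball (Phi p) r \<subseteq> cod"
    using open_cod Phi_in_cod[OF pd] openE by blast
  define V where "V = ball (Phi p) r"
  define U where "U = dom \<inter> Phi -` V"
  define T where "T = {w :: complex ^ 'n. \<forall>j\<in>J. Re (w $ j) = 0}"
  have V: "open V" "convex V" "V \<subseteq> cod" "Phi p \<in> V"
    using r by (auto simp: V_def)
  have "continuous_on dom Phi"
    using smooth_on_Ck[OF smooth_on_Phi, of 0] by simp
  then have U: "open U"
    unfolding U_def by (intro continuous_open_preimage open_dom V)
  have UV: "Phi z \<in> V" "Psi (Phi z) = z" if "z \<in> U" for z
    using that by (auto simp: U_def Psi_Phi)
  have VU: "Psi w \<in> U" "Phi (Psi w) = w" if "w \<in> V" for w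
    using that V(3) by (auto simp: U_def Phi_Psi Psi_in_dom subset_iff)
  have sU: "smooth_on U Phi" and sV: "smooth_on V Psi"
    using smooth_on_subset[OF smooth_on_Phi, of U] smooth_on_subset[OF smooth_on_Psi V(3)]
    by (auto simp: U_def)
  have homeo: "homeomorphism U V Phi Psi"
    using smooth_on_Ck[OF sU, of 0] smooth_on_Ck[OF sV, of 0] UV VU
    by (intro homeomorphismI) auto
  have img: "Phi ` (U \<inter> moment_angle_manifold \<Lambda>) = V \<inter> T"
  proof (intro subset_antisym subsetI)
    fix w assume "w \<in> V \<inter> T"
    then have "Psi w \<in> U \<inter> moment_angle_manifold \<Lambda>" "w = Phi (Psi w)"
      using VU by (auto simp: moment_angle_manifold_Phi T_def)
    then show "w \<in> Phi ` (U \<inter> moment_angle_manifold \<Lambda>)" by blast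
  qed (auto simp: UV moment_angle_manifold_Phi T_def)
  have subT: "subspace T"
    by (auto simp: T_def subspace_def)
  have dimT: "dim T = 2 * CARD('n) - 2 * CARD('m) - 1"
    using dim_Re_zero[of J] card by (simp add: T_def)
  have inj: "inj shift"
  proof (rule linear_injective_0[OF linear_shift, THEN iffD2], intro allI impI)
    fix u assume "shift u = 0"
    then show "u = 0"
      by (intro lifted_span_separates[OF sp]) (auto simp: shift_def vec_eq_iff split: if_splits)
  qed
  have ran: "range shift \<subseteq> T"
    by (auto simp: shift_def T_def)
  have "p \<in> U" using pd V(4) by (simp add: U_def)
  from that[OF this U V(1,2) homeo sU sV subT dimT img linear_shift inj ran] Psi_shift
  show ?thesis by blast
qed

section \<open>The symplectic leaves\<close>

text \<open>The component z of x orthogonal to S satisfies \<open>x \<bullet> z = 0\<close>, hence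
  is 0. For S the range of s, membership is thereby tested by scalar transverse coordinates.\<close>

lemma in_subspace_if_orthogonal:
  fixes S :: "'a::euclidean_space set"
  assumes "subspace S" "\<And>z. (\<And>y. y \<in> S \<Longrightarrow> y \<bullet> z = 0) \<Longrightarrow> x \<bullet> z = 0"
  shows "x \<in> S"
proof -
  obtain y z where yz: "y \<in> span S" "\<And>w. w \<in> span S \<Longrightarrow> orthogonal z w" "x = y + z"
    by (rule orthogonal_subspace_decomp_exists[of S x]) blast
  have "x \<bullet> z = 0" "y \<bullet> z = 0"
    using assms(2)[of z] yz by (auto simp: orthogonal_def inner_commute span_base)
  then have "z = 0" using yz(3) by (simp add: inner_add_left)
  then show ?thesis using yz assms(1) by (metis add.right_neutral span_eq_iff)
qed

text \<open>Each neighbourhood of constancy contains a point of a countable dense set, so every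
  value on W is attained there, possibly at a point outside W.\<close>

lemma countable_image_if_locally_constant:
  fixes W :: "'a::second_countable_topology set"
  assumes "\<And>u. u \<in> W \<Longrightarrow> \<exists>X. open X \<and> u \<in> X \<and> (\<forall>v\<in>X. h v = h u)"
  shows "countable (h ` W)"
proof -
  obtain D :: "'a set" where D: "countable D" "\<And>X. open X \<Longrightarrow> X \<noteq> {} \<Longrightarrow> \<exists>d\<in>D. d \<in> X"
    using countable_dense_setE by metis
  have "h ` W \<subseteq> h ` D"
  proof clarify
    fix u assume "u \<in> W"
    then obtain X where "open X" "u \<in> X" "\<forall>v\<in>X. h v = h u" using assms by blast
    moreover from this obtain d where "d \<in> D" "d \<in> X" using D(2) by blast
    ultimately show "h u \<in> h ` D" by (metis imageI)
  qed
  then show ?thesis using countable_image[OF D(1)] by (rule countable_subset)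
qed

section \<open>Orbits partition the manifold\<close>

definition torus_orbit :: "complex ^ 'm ^ 'n \<Rightarrow> complex ^ 'n \<Rightarrow> (complex ^ 'n) set" where
  "torus_orbit \<Lambda> p = range (\<lambda>u. torus_act \<Lambda> u p)"

lemma torus_orbit_self: "p \<in> torus_orbit \<Lambda> p"
  unfolding torus_orbit_def by (rule range_eqI[of _ _ 0]) simp

lemma torus_orbit_sym: "q \<in> torus_orbit \<Lambda> p \<Longrightarrow> p \<in> torus_orbit \<Lambda> q"
proof -
  assume "q \<in> torus_orbit \<Lambda> p"
  then obtain u where "q = torus_act \<Lambda> u p" by (auto simp: torus_orbit_def)
  then have "p = torus_act \<Lambda> (- u) q" by simp
  then show ?thesis unfolding torus_orbit_def by (rule range_eqI)
qed

lemma torus_orbit_trans: "q \<in> torus_orbit \<Lambda> p \<Longrightarrow> r \<in> torus_orbit \<Lambda> q \<Longrightarrow> r \<in> torus_orbit \<Lambda> p"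
  unfolding torus_orbit_def by auto

lemma torus_orbit_eq: "q \<in> torus_orbit \<Lambda> p \<Longrightarrow> torus_orbit \<Lambda> q = torus_orbit \<Lambda> p"
  using torus_orbit_sym torus_orbit_trans by blast

lemma torus_orbit_subset:
  "p \<in> moment_angle_manifold \<Lambda> \<Longrightarrow> torus_orbit \<Lambda> p \<subseteq> moment_angle_manifold \<Lambda>"
  by (auto simp: torus_orbit_def)

lemma continuous_on_torus_act: "continuous_on A (\<lambda>u. torus_act \<Lambda> u Z)"
  by (rule continuous_on_subset[OF smooth_on_Ck[OF smooth_on_torus_act, of 0, unfolded Ck_on.simps(1)]]) simp

lemma partition_on_torus_orbits:
  "partition_on (moment_angle_manifold \<Lambda>) (torus_orbit \<Lambda> ` moment_angle_manifold \<Lambda>)"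
proof (rule partition_onI)
  show "\<Union> (torus_orbit \<Lambda> ` moment_angle_manifold \<Lambda>) = moment_angle_manifold \<Lambda>"
    using torus_orbit_self torus_orbit_subset by blast
  show "{} \<notin> torus_orbit \<Lambda> ` moment_angle_manifold \<Lambda>"
    using torus_orbit_self by blast
  show "disjnt L L'" if "L \<in> torus_orbit \<Lambda> ` moment_angle_manifold \<Lambda>"
    "L' \<in> torus_orbit \<Lambda> ` moment_angle_manifold \<Lambda>" "L \<noteq> L'" for L L'
    using that torus_orbit_eq unfolding disjnt_iff by blast
qed

text \<open>In the chart the orbit curve is the straight line with direction \<open>s u\<close>
  while it stays in V; both sides are its velocity at time 0.\<close>

lemma frechet_derivative_equivariant_chart:
  fixes \<Lambda> :: "complex ^ 'm::finite ^ 'n::finite" and V :: "(complex ^ 'n) set"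
  assumes V: "open V" and h: "homeomorphism U V \<Phi> \<Psi>" and s\<Phi>: "smooth_on U \<Phi>" and s: "linear s"
    and eq: "\<And>w u. \<Psi> (w + s u) = torus_act \<Lambda> u (\<Psi> w)" and q: "q \<in> U"
  shows "frechet_derivative \<Phi> (at q) (torus_field \<Lambda> u q) = s u"
proof -
  let ?A = "(\<lambda>t. \<Phi> q + t *\<^sub>R s u) -` V"
  have inv: "\<Psi> (\<Phi> q) = q" "\<Phi> q \<in> V" and inv': "\<Phi> (\<Psi> w) = w" if "w \<in> V" for w
    using h q that by (auto simp: homeomorphism_def)
  have A: "open ?A" "0 \<in> ?A"
    using V q h by (auto intro!: open_vimage continuous_intros simp: homeomorphism_def)
  have "((\<lambda>t. \<Phi> q + t *\<^sub>R s u) has_derivative (\<lambda>t. t *\<^sub>R s u)) (at 0)"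
    by (auto intro!: derivative_eq_intros)
  moreover have "\<Phi> q + t *\<^sub>R s u = \<Phi> (torus_act \<Lambda> (t *\<^sub>R u) q)" if "t \<in> ?A" for t
    using inv'[of "\<Phi> q + t *\<^sub>R s u"] eq[of "\<Phi> q" "t *\<^sub>R u"] inv that s by (simp add: linear_scale)
  ultimately have "((\<lambda>t. \<Phi> (torus_act \<Lambda> (t *\<^sub>R u) q)) has_derivative (\<lambda>t. t *\<^sub>R s u)) (at 0)"
    by (rule has_derivative_transform_within_open[OF _ A])
  moreover have "((\<lambda>t. \<Phi> (torus_act \<Lambda> (t *\<^sub>R u) q)) has_derivative
      (\<lambda>t. frechet_derivative \<Phi> (at q) (t *\<^sub>R torus_field \<Lambda> u q))) (at 0)"
    using has_derivative_compose[of "\<lambda>t. torus_act \<Lambda> (t *\<^sub>R u) q" _ 0 UNIV \<Phi>]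
      torus_act_has_vector_derivative[of \<Lambda> u q 0] smooth_on_has_derivative[OF s\<Phi> q]
    by (simp add: has_vector_derivative_def)
  ultimately have "(\<lambda>t. frechet_derivative \<Phi> (at q) (t *\<^sub>R torus_field \<Lambda> u q)) = (\<lambda>t. t *\<^sub>R s u)"
    using has_derivative_unique by blast
  from fun_cong[OF this, of 1] show ?thesis by simp
qed

text \<open>Off N the path moves along \<open>range s\<close> in the chart, so each transverse
  coordinate is continuous with zero derivative apart from finitely many times, hence constant.
  Equivariance turns the resulting displacement \<open>s u\<close> into the action of u.\<close>

lemma characteristic_path_locally_in_orbit:
  fixes \<Lambda> :: "complex ^ 'm::finite ^ 'n::finite" and V :: "(complex ^ 'n) set"
  assumes V: "open V" and U: "open U" and h: "homeomorphism U V \<Phi> \<Psi>" and s\<Phi>: "smooth_on U \<Phi>" and s: "linear s"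
    and eq: "\<And>w u. \<Psi> (w + s u) = torus_act \<Lambda> u (\<Psi> w)"
    and N: "finite N" and cont: "continuous_on {c..d} \<gamma>" and cd: "c \<le> d" and \<gamma>U: "\<gamma> ` {c..d} \<subseteq> U"
    and deriv: "\<And>t. t \<in> {c..d} - N \<Longrightarrow> \<exists>u. (\<gamma> has_vector_derivative torus_field \<Lambda> u (\<gamma> t)) (at t)"
  shows "\<gamma> d \<in> torus_orbit \<Lambda> (\<gamma> c)"
proof -
  have c\<Phi>: "continuous_on U \<Phi>"
    using smooth_on_Ck[OF s\<Phi>, of 0] by simp
  have "\<Phi> (\<gamma> d) - \<Phi> (\<gamma> c) \<in> range s"
  proof (rule in_subspace_if_orthogonal)
    show "subspace (range s)" using s by (simp add: linear_subspace_image)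
    fix z assume z: "\<And>y. y \<in> range s \<Longrightarrow> y \<bullet> z = 0"
    have "\<Phi> (\<gamma> d) \<bullet> z = \<Phi> (\<gamma> c) \<bullet> z"
    proof (rule has_derivative_zero_unique_strong_interval[OF N, where a = c and b = d and x = d and f = "\<lambda>t. \<Phi> (\<gamma> t) \<bullet> z"])
      show "continuous_on {c..d} (\<lambda>t. \<Phi> (\<gamma> t) \<bullet> z)"
        by (intro continuous_on_inner continuous_on_const continuous_on_compose2[OF c\<Phi> cont \<gamma>U])
      fix t assume t: "t \<in> {c..d} - N"
      then obtain u where u: "(\<gamma> has_vector_derivative torus_field \<Lambda> u (\<gamma> t)) (at t)"
        using deriv by blast
      have \<gamma>t: "\<gamma> t \<in> U" using t \<gamma>U by auto
      have lin: "linear (frechet_derivative \<Phi> (at (\<gamma> t)))"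
        by (rule has_derivative_linear[OF smooth_on_has_derivative[OF s\<Phi> \<gamma>t]])
      have "((\<lambda>t. \<Phi> (\<gamma> t)) has_derivative (\<lambda>r. frechet_derivative \<Phi> (at (\<gamma> t)) (r *\<^sub>R torus_field \<Lambda> u (\<gamma> t)))) (at t)"
        using has_derivative_compose[OF u[unfolded has_vector_derivative_def] smooth_on_has_derivative[OF s\<Phi> \<gamma>t]] .
      then have "((\<lambda>t. \<Phi> (\<gamma> t)) has_derivative (\<lambda>r. r *\<^sub>R s u)) (at t)"
        by (simp add: linear_scale[OF lin] frechet_derivative_equivariant_chart[OF V h s\<Phi> s eq \<gamma>t])
      then have "((\<lambda>t. \<Phi> (\<gamma> t) \<bullet> z) has_derivative (\<lambda>r. (r *\<^sub>R s u) \<bullet> z)) (at t)"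
        by (rule has_derivative_inner_left)
      then show "((\<lambda>t. \<Phi> (\<gamma> t) \<bullet> z) has_derivative (\<lambda>h. 0)) (at t within {c..d})"
        using z by (simp add: has_derivative_at_withinI)
    qed (use cd in auto)
    then show "(\<Phi> (\<gamma> d) - \<Phi> (\<gamma> c)) \<bullet> z = 0" by (simp add: inner_diff_left)
  qed
  then obtain u where "\<Phi> (\<gamma> d) = \<Phi> (\<gamma> c) + s u"
    by (metis add.commute diff_add_cancel imageE)
  moreover have "\<Psi> (\<Phi> (\<gamma> c)) = \<gamma> c" "\<Psi> (\<Phi> (\<gamma> d)) = \<gamma> d"
    using h \<gamma>U cd by (simp_all add: homeomorphism_def image_subset_iff)
  ultimately have "\<gamma> d = torus_act \<Lambda> u (\<gamma> c)"
    using eq by metis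
  then show ?thesis by (simp add: torus_orbit_def)
qed

text \<open>Inside one chart a characteristic path keeps to an orbit, and the connectedness of the
  time interval propagates this. Conversely, the group is a vector space, so the segment from 0 to u
  moves p along a characteristic path.\<close>

lemma symplectic_leaf_eq_torus_orbit:
  fixes \<Lambda> :: "complex ^ 'm::finite ^ 'n::finite"
  assumes n: "CARD('n) > 2 * CARD('m)" and wh: "weakly_hyperbolic \<Lambda>"
    and p: "p \<in> moment_angle_manifold \<Lambda>"
  shows "symplectic_leaf (moment_angle_manifold \<Lambda>) (torus_bracket \<Lambda>) p = torus_orbit \<Lambda> p"
proof (intro subset_antisym subsetI)
  let ?M = "moment_angle_manifold \<Lambda>"
  note char = characteristic_space_torus_bracket[OF _ inj_torus_field[OF n wh]]
  {
    fix q assume "q \<in> symplectic_leaf ?M (torus_bracket \<Lambda>) p"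
    then obtain \<gamma> N where \<gamma>: "path \<gamma>" "path_image \<gamma> \<subseteq> ?M" "\<gamma> 0 = p" "\<gamma> 1 = q" and N: "finite N"
      and C1: "\<gamma> C1_differentiable_on ({0..1} - N)"
      and d: "\<And>t. t \<in> {0..1} - N \<Longrightarrow> vector_derivative \<gamma> (at t) \<in> characteristic_space ?M (torus_bracket \<Lambda>) (\<gamma> t)"
      unfolding symplectic_leaf_def characteristic_path_def pathstart_def pathfinish_def by blast
    have \<gamma>M: "\<gamma> t \<in> ?M" if "t \<in> {0..1}" for t
      using \<gamma>(2) that by (auto simp: path_image_def)
    have cont: "continuous_on {0..1} \<gamma>"
      using \<gamma>(1) by (simp add: path_def)
    have deriv: "\<exists>u. (\<gamma> has_vector_derivative torus_field \<Lambda> u (\<gamma> t)) (at t)" if t: "t \<in> {0..1} - N" for t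
    proof -
      have "(\<gamma> has_vector_derivative vector_derivative \<gamma> (at t)) (at t)"
        using C1 t unfolding C1_differentiable_on_def by (metis vector_derivative_at)
      moreover have "vector_derivative \<gamma> (at t) \<in> range (\<lambda>u. torus_field \<Lambda> u (\<gamma> t))"
        using d[OF t] char[of "\<gamma> t"] \<gamma>M t by auto
      ultimately show ?thesis by auto
    qed
    have "\<gamma> 1 \<in> torus_orbit \<Lambda> (\<gamma> 0)"
    proof (rule connected_equivalence_relation[of "{0..1::real}" 0 1 "\<lambda>x y. \<gamma> y \<in> torus_orbit \<Lambda> (\<gamma> x)"])
      fix t0 :: real assume t0: "t0 \<in> {0..1}"
      obtain U V \<Phi> \<Psi> T s where c: "\<gamma> t0 \<in> U" "open U" "open (V :: (complex ^ 'n) set)" "convex V" "homeomorphism U V \<Phi> \<Psi>"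
        "smooth_on U \<Phi>" "smooth_on V \<Psi>" "subspace T" "dim T = 2 * CARD('n) - 2 * CARD('m) - 1"
        "\<Phi> ` (U \<inter> ?M) = V \<inter> T" "linear s" "inj s" "range s \<subseteq> T"
        "\<forall>w u. \<Psi> (w + s u) = torus_act \<Lambda> u (\<Psi> w)"
        by (rule adapted_chart_exists[OF n wh \<gamma>M[OF t0]])
      have "openin (top_of_set {0..1}) ({0..1} \<inter> \<gamma> -` U)"
        using cont c(2) by (rule continuous_openin_preimage_gen)
      moreover have "t0 \<in> {0..1} \<inter> \<gamma> -` U" using t0 c(1) by simp
      ultimately obtain r where r: "r > 0" "ball t0 r \<inter> {0..1} \<subseteq> {0..1} \<inter> \<gamma> -` U"
        unfolding openin_contains_ball by blast
      have *: "\<gamma> y \<in> torus_orbit \<Lambda> (\<gamma> x)"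
        if "x \<in> ball t0 r \<inter> {0..1}" "y \<in> ball t0 r \<inter> {0..1}" "x \<le> y" for x y
      proof (rule characteristic_path_locally_in_orbit[OF c(3,2,5,6,11) c(14)[rule_format] N])
        have sub: "{x..y} \<subseteq> ball t0 r \<inter> {0..1}"
          using that by (auto simp: dist_real_def)
        then show "continuous_on {x..y} \<gamma>" "\<gamma> ` {x..y} \<subseteq> U"
          using r(2) continuous_on_subset[OF cont] by blast+
        show "\<exists>u. (\<gamma> has_vector_derivative torus_field \<Lambda> u (\<gamma> t)) (at t)" if "t \<in> {x..y} - N" for t
          using that sub by (intro deriv) auto
      qed (rule that)
      \<comment> \<open>The local result needs ordered times; symmetry of the orbit relation covers
        times before t0.\<close>
      have "\<gamma> x \<in> torus_orbit \<Lambda> (\<gamma> t0)" if x: "x \<in> ball t0 r \<inter> {0..1}" for x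
        using *[of x t0] *[of t0 x] x t0 r(1) torus_orbit_sym by (cases "x \<le> t0") auto
      then show "\<exists>T. openin (top_of_set {0..1}) T \<and> t0 \<in> T \<and> (\<forall>x\<in>T. \<gamma> x \<in> torus_orbit \<Lambda> (\<gamma> t0))"
        using t0 r(1) by (intro exI[of _ "{0..1} \<inter> ball t0 r"]) (auto intro!: openin_open_Int)
    qed (auto intro: torus_orbit_sym torus_orbit_trans)
    then show "q \<in> torus_orbit \<Lambda> p" using \<gamma> by simp
  }
  fix q assume "q \<in> torus_orbit \<Lambda> p"
  then obtain u where u: "q = torus_act \<Lambda> u p" by (auto simp: torus_orbit_def)
  let ?\<gamma> = "\<lambda>t. torus_act \<Lambda> (t *\<^sub>R u) p"
  have cont: "continuous_on A ?\<gamma>" for A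
    by (rule continuous_on_subset[OF smooth_on_Ck[OF smooth_on_torus_act_line, of 0, unfolded Ck_on.simps(1)]]) simp
  have "characteristic_path ?M (torus_bracket \<Lambda>) ?\<gamma>"
    unfolding characteristic_path_def
  proof (intro conjI exI[of _ "{}"] ballI)
    show "?\<gamma> C1_differentiable_on {0..1} - {}"
      unfolding C1_differentiable_on_def
      using torus_act_has_vector_derivative[of \<Lambda> u p]
        bounded_linear.continuous_on[OF bounded_linear_torus_field cont]
      by (intro exI[of _ "\<lambda>t. torus_field \<Lambda> u (?\<gamma> t)"]) blast
    show "vector_derivative ?\<gamma> (at t) \<in> characteristic_space ?M (torus_bracket \<Lambda>) (?\<gamma> t)" for t
      using char[of "?\<gamma> t"] p vector_derivative_at[OF torus_act_has_vector_derivative[of \<Lambda> u p t]] by simp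
  qed (use p cont in \<open>auto simp: path_def path_image_def\<close>)
  then show "q \<in> symplectic_leaf ?M (torus_bracket \<Lambda>) p"
    unfolding symplectic_leaf_def using u by (auto simp: pathstart_def pathfinish_def intro!: exI[of _ ?\<gamma>])
qed

text \<open>The transverse coordinates take only countably many values on \<open>U \<inter> L\<close>, since they are locally constant along
  the action; hence they are constant on each component, even when the leaf \<open>L\<close> accumulates on itself.\<close>

lemma component_torus_orbit:
  fixes \<Lambda> :: "complex ^ 'm::finite ^ 'n::finite" and V :: "(complex ^ 'n) set"
  assumes V: "open V" "convex V" and U: "open U" and h: "homeomorphism U V \<Phi> \<Psi>" and s: "linear s"
    and eq: "\<And>w u. \<Psi> (w + s u) = torus_act \<Lambda> u (\<Psi> w)"
    and q: "q \<in> moment_angle_manifold \<Lambda>" and C: "C \<in> components (U \<inter> torus_orbit \<Lambda> q)" and x: "x \<in> C"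
  shows "C = {y \<in> U \<inter> moment_angle_manifold \<Lambda>. \<Phi> y - \<Phi> x \<in> range s}"
proof (intro subset_antisym subsetI)
  have inv: "\<Psi> (\<Phi> y) = y" "\<Phi> y \<in> V" if "y \<in> U" for y
    using h that by (auto simp: homeomorphism_def)
  have inv': "\<Phi> (\<Psi> w) = w" "\<Psi> w \<in> U" if "w \<in> V" for w
    using h that by (auto simp: homeomorphism_def)
  have C_sub: "C \<subseteq> U \<inter> torus_orbit \<Lambda> q"
    using C by (rule in_components_subset)
  then have xU: "x \<in> U" and xq: "torus_orbit \<Lambda> x = torus_orbit \<Lambda> q"
    using x torus_orbit_eq by blast+
  {
    fix y assume y: "y \<in> {y \<in> U \<inter> moment_angle_manifold \<Lambda>. \<Phi> y - \<Phi> x \<in> range s}"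
    \<comment> \<open>The slice through \<open>\<Phi> x\<close> is convex, so its preimage is a
      connected part of the leaf and lies in the component of x.\<close>
    let ?W = "V \<inter> (\<lambda>w. \<Phi> x + w) ` range s"
    have "convex ?W"
      by (intro convex_Int V(2) convex_translation subspace_imp_convex linear_subspace_image s subspace_UNIV)
    moreover have "continuous_on V \<Psi>"
      using h by (simp add: homeomorphism_def)
    ultimately have "connected (\<Psi> ` ?W)"
      by (intro connected_continuous_image convex_connected) (auto intro: continuous_on_subset)
    moreover have "\<Psi> ` ?W \<subseteq> U \<inter> torus_orbit \<Lambda> q"
    proof clarify
      fix u assume "\<Phi> x + s u \<in> V"
      moreover have "\<Psi> (\<Phi> x + s u) = torus_act \<Lambda> u x"
        by (simp add: eq inv(1)[OF xU])
      moreover have "torus_act \<Lambda> u x \<in> torus_orbit \<Lambda> x"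
        by (simp add: torus_orbit_def)
      ultimately show "\<Psi> (\<Phi> x + s u) \<in> U \<inter> torus_orbit \<Lambda> q"
        using inv'(2)[of "\<Phi> x + s u"] by (simp add: xq)
    qed
    moreover have "x \<in> \<Psi> ` ?W"
      using inv[OF xU] linear_0[OF s] by (intro image_eqI[of _ _ "\<Phi> x"]) (auto intro!: image_eqI[of _ _ 0] range_eqI[of _ _ 0])
    ultimately have "\<Psi> ` ?W \<subseteq> C"
      using components_maximal[OF C] x by blast
    moreover have "\<Phi> y \<in> ?W"
      using y inv(2)[of y] by (auto simp: algebra_simps intro!: image_eqI[of _ _ "\<Phi> y - \<Phi> x"])
    ultimately show "y \<in> C"
      using inv(1)[of y] y by (metis (no_types, lifting) IntD1 image_subset_iff mem_Collect_eq)
  }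
  fix y assume y: "y \<in> C"
  have "\<Phi> y - \<Phi> x \<in> range s"
  proof (rule in_subspace_if_orthogonal)
    show "subspace (range s)" using s by (simp add: linear_subspace_image)
    fix z assume z: "\<And>y. y \<in> range s \<Longrightarrow> y \<bullet> z = 0"
    \<comment> \<open>These parameters cover the whole trace of the leaf in U, including all its
      returns.\<close>
    let ?W = "{u. torus_act \<Lambda> u x \<in> U}"
    have "countable ((\<lambda>u. \<Phi> (torus_act \<Lambda> u x) \<bullet> z) ` ?W)"
    proof (rule countable_image_if_locally_constant)
      fix u assume "u \<in> ?W"
      then have u: "torus_act \<Lambda> u x \<in> U" by simp
      \<comment> \<open>While the translate stays in V, \<open>\<Phi>\<close> inverts
        \<open>\<Psi>\<close> on it, so moving from u to v changes the chart value by
        \<open>s (v - u)\<close> only.\<close>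
      let ?X = "(\<lambda>v. \<Phi> (torus_act \<Lambda> u x) + s (v - u)) -` V"
      have "open ?X"
        by (rule open_vimage[OF V(1)], rule continuous_on_add[OF continuous_on_const],
            rule linear_continuous_on_compose[OF _ s]) (intro continuous_intros)
      moreover have "u \<in> ?X" using inv(2)[OF u] linear_0[OF s] by simp
      moreover have "\<Phi> (torus_act \<Lambda> v x) \<bullet> z = \<Phi> (torus_act \<Lambda> u x) \<bullet> z" if "v \<in> ?X" for v
      proof -
        have "\<Psi> (\<Phi> (torus_act \<Lambda> u x) + s (v - u)) = torus_act \<Lambda> v x"
          by (simp add: eq inv(1)[OF u])
        then have "\<Phi> (torus_act \<Lambda> v x) = \<Phi> (torus_act \<Lambda> u x) + s (v - u)"
          using inv'(1) that by (metis vimageE)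
        then show ?thesis using z by (simp add: inner_add_left)
      qed
      ultimately show "\<exists>X. open X \<and> u \<in> X \<and> (\<forall>v\<in>X. \<Phi> (torus_act \<Lambda> v x) \<bullet> z = \<Phi> (torus_act \<Lambda> u x) \<bullet> z)"
        by blast
    qed
    moreover have "(\<lambda>y. \<Phi> y \<bullet> z) ` C \<subseteq> (\<lambda>u. \<Phi> (torus_act \<Lambda> u x) \<bullet> z) ` ?W"
    proof clarify
      fix y assume "y \<in> C"
      then have "y \<in> U" "y \<in> torus_orbit \<Lambda> x" using C_sub xq by auto
      then show "\<Phi> y \<bullet> z \<in> (\<lambda>u. \<Phi> (torus_act \<Lambda> u x) \<bullet> z) ` ?W"
        by (auto simp: torus_orbit_def)
    qed
    ultimately have count: "countable ((\<lambda>y. \<Phi> y \<bullet> z) ` C)"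
      using countable_subset by blast
    have "continuous_on C (\<lambda>y. \<Phi> y \<bullet> z)"
      using h C_sub by (intro continuous_intros) (auto simp: homeomorphism_def intro: continuous_on_subset)
    then have "connected ((\<lambda>y. \<Phi> y \<bullet> z) ` C)"
      using in_components_connected[OF C] by (rule connected_continuous_image)
    \<comment> \<open>A connected set of reals with two distinct points is uncountable.\<close>
    then have "\<Phi> y \<bullet> z = \<Phi> x \<bullet> z"
      using connected_uncountable[of _ "\<Phi> y \<bullet> z" "\<Phi> x \<bullet> z"] count x y by blast
    then show "(\<Phi> y - \<Phi> x) \<bullet> z = 0" by (simp add: inner_diff_left)
  qed
  then show "y \<in> {y \<in> U \<inter> moment_angle_manifold \<Lambda>. \<Phi> y - \<Phi> x \<in> range s}"
    using y C_sub torus_orbit_subset[OF q] by blast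
qed

theorem proposition2:
  fixes \<Lambda> :: "complex ^ 'm::finite ^ 'n::finite"
  assumes "CARD('n) > 3"
    and "CARD('n) > 2 * CARD('m)"
    and "admissible_configuration \<Lambda>"
  shows "smooth_submanifold (2 * CARD('n) - 2 * CARD('m) - 1) (moment_angle_manifold \<Lambda>) \<and>
    (\<exists>B. regular_poisson_structure (moment_angle_manifold \<Lambda>) B \<and>
         foliation (2 * CARD('m)) (moment_angle_manifold \<Lambda>)
           (symplectic_foliation (moment_angle_manifold \<Lambda>) B))"
proof -
  let ?M = "moment_angle_manifold \<Lambda>"
  have n: "CARD('n) > 2 * CARD('m)" and wh: "weakly_hyperbolic \<Lambda>"
    using assms by (auto simp: admissible_configuration_def)
  have slice: "slice_chart ?M U \<Phi> T"
    if "open U" "open V" "homeomorphism U V \<Phi> \<Psi>" "smooth_on U \<Phi>" "smooth_on V \<Psi>" "subspace T"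
      "\<Phi> ` (U \<inter> ?M) = V \<inter> T" for U V \<Phi> \<Psi> T
    using that unfolding slice_chart_def by blast
  have "smooth_submanifold (2 * CARD('n) - 2 * CARD('m) - 1) ?M"
    unfolding smooth_submanifold_def
  proof
    fix p assume p: "p \<in> ?M"
    show "\<exists>U \<Phi> T. p \<in> U \<and> slice_chart ?M U \<Phi> T \<and> dim T = 2 * CARD('n) - 2 * CARD('m) - 1"
      by (rule adapted_chart_exists[OF n wh p]) (blast intro: slice)
  qed
  moreover have "regular_poisson_structure ?M (torus_bracket \<Lambda>)"
  proof -
    \<comment> \<open>The rank is the real dimension of \<open>complex ^ 'm\<close>, carried over by
      an injective linear map.\<close>
    have "dim (characteristic_space ?M (torus_bracket \<Lambda>) p) = 2 * CARD('m)" if p: "p \<in> ?M" for p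
      using characteristic_space_torus_bracket[OF p inj_torus_field[OF n wh p]]
        dim_image_eq[OF linear_torus_field[of \<Lambda> p], of UNIV] inj_torus_field[OF n wh p]
      by (simp add: mult.commute)
    then show ?thesis
      unfolding regular_poisson_structure_def using poisson_structure_torus_bracket by blast
  qed
  moreover have "foliation (2 * CARD('m)) ?M (symplectic_foliation ?M (torus_bracket \<Lambda>))"
  proof -
    have leaves: "symplectic_foliation ?M (torus_bracket \<Lambda>) = torus_orbit \<Lambda> ` ?M"
      unfolding symplectic_foliation_def using symplectic_leaf_eq_torus_orbit[OF n wh] by simp
    have conn: "connected (torus_orbit \<Lambda> p)" for p
      unfolding torus_orbit_def by (intro connected_continuous_image continuous_on_torus_act connected_UNIV)
    have "\<exists>U \<Phi> T S. p \<in> U \<and> slice_chart ?M U \<Phi> T \<and> subspace S \<and> S \<subseteq> T \<and> dim S = 2 * CARD('m) \<and>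
        (\<forall>L\<in>torus_orbit \<Lambda> ` ?M. \<forall>C\<in>components (U \<inter> L). \<exists>c. C = {x \<in> U \<inter> ?M. \<Phi> x - c \<in> S})"
      if p: "p \<in> ?M" for p
    proof -
      obtain U V \<Phi> \<Psi> T s where c: "p \<in> U" "open U" "open (V :: (complex ^ 'n) set)" "convex V" "homeomorphism U V \<Phi> \<Psi>"
        "smooth_on U \<Phi>" "smooth_on V \<Psi>" "subspace T" "dim T = 2 * CARD('n) - 2 * CARD('m) - 1"
        "\<Phi> ` (U \<inter> ?M) = V \<inter> T" "linear s" "inj s" "range s \<subseteq> T"
        "\<forall>w u. \<Psi> (w + s u) = torus_act \<Lambda> u (\<Psi> w)"
        by (rule adapted_chart_exists[OF n wh p])
      have "\<exists>c. C = {x \<in> U \<inter> ?M. \<Phi> x - c \<in> range s}"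
        if "L \<in> torus_orbit \<Lambda> ` ?M" "C \<in> components (U \<inter> L)" for L C
      proof -
        obtain q where q: "q \<in> ?M" "L = torus_orbit \<Lambda> q" using \<open>L \<in> _\<close> by blast
        \<comment> \<open>Any point x of the component provides the base point
          \<open>\<Phi> x\<close> of its slice.\<close>
        obtain x where "x \<in> C" using in_components_nonempty[OF \<open>C \<in> _\<close>] by blast
        then show ?thesis
          using component_torus_orbit[OF c(3,4,2,5,11) c(14)[rule_format] q(1), of C x] that(2) q(2) by blast
      qed
      moreover have "dim (range s) = 2 * CARD('m)"
        using dim_image_eq[OF c(11), of UNIV] c(12) by (simp add: mult.commute)
      moreover have "subspace (range s)" using c(11) by (simp add: linear_subspace_image)
      ultimately show ?thesis
        using c(1,13) slice[OF c(2,3,5-8,10)] by blast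
    qed
    then show ?thesis
      unfolding foliation_def leaves using partition_on_torus_orbits conn by blast
  qed
  ultimately show ?thesis by blast
qed

end
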